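(* Let $k\in\mathbb{Z}_{\ge 1}$, $\zeta\in\mathbb{D}$ and $f\in\operatorname{Hol}(\mathbb{D})$. Then $$D_{\zeta,k}(f)=D_{\sigma,k-1}\left(\frac{f(z)-f(\zeta)}{z-\zeta}\right),$$ as an equality in $[0,\infty]$.
   Context: $\mathbb{D}$ is the open unit disc in $\mathbb{C}$, $\operatorname{Hol}(\mathbb{D})$ the space of holomorphic functions on $\mathbb{D}$, $dA=\frac1\pi\,dx\,dy$ the normalized area measure on $\mathbb{D}$, $\sigma$ the normalized arc-length measure on the unit circle, and $H^2$ the Hardy space of $\mathbb{D}$ (with $\|f\|_{H^2}=\infty$ if $f\notin H^2$). For $k\ge1$ and $z\ne\zeta$ in $\mathbb{D}$ let $$G_k(z,\zeta)=|\zeta-z|^{2(k-1)}\log\left|\frac{1-z\overline\zeta}{\zeta-z}\right|^2+\sum_{l=1}^{k-1}\frac{(-1)^l}{l}|\zeta-z|^{2(k-1-l)}(1-|\zeta|^2)^l(1-|z|^2)^l .$$ For $\zeta\in\mathbb{D}$ and $f\in\operatorname{Hol}(\mathbb{D})$, $$D_{\zeta,k}(f)=\int_{\mathbb{D}}|f^{(k)}(z)|^2\,U_{\zeta,k}(z)\,dA(z),\qquad U_{\zeta,k}(z)=\frac{(-1)^{k+1}G_k(z,\zeta)}{((k-1)!)^2(1-|\zeta|^2)^k}\ (\ge 0).$$ Moreover $D_{\sigma,0}(f)=\|f\|_{H^2}^2$, and for $n\ge1$ $$D_{\sigma,n}(f)=\frac{1}{n!(n-1)!}\int_{\mathbb{D}}|f^{(n)}(z)|^2(1-|z|^2)^{n-1}\,dA(z).$$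 The function $z\mapsto\frac{f(z)-f(\zeta)}{z-\zeta}$ is extended holomorphically to $z=\zeta$. *)

theory Defs
  imports "HOL-Complex_Analysis.Complex_Analysis"
begin

abbreviation unit_disc :: "complex set" where
  "unit_disc \<equiv> ball 0 1"

definition disc_area :: "complex measure" where
  "disc_area = scale_measure (ennreal (1 / pi)) (restrict_space lborel unit_disc)"

text \<open>Normalized arc length on the unit circle, as a Borel measure on the plane.\<close>
definition circle_arclen :: "complex measure" where
  "circle_arclen =
     distr (scale_measure (ennreal (1 / (2 * pi))) (restrict_space lborel {0..2 * pi})) borel cis"

text \<open>The squared \<open>H\<^sup>2\<close> norm of a function on the disc, as the supremum of its integral means;
  the value is \<open>\<infinity>\<close> exactly when a holomorphic function is not in \<open>H\<^sup>2\<close>.\<close>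
definition hardy2_norm_sq :: "(complex \<Rightarrow> complex) \<Rightarrow> ennreal" where
  "hardy2_norm_sq f =
     (SUP r\<in>{0..<1::real}. \<integral>\<^sup>+ w. ennreal ((cmod (f (of_real r * w)))\<^sup>2) \<partial>circle_arclen)"

text \<open>The diagonal value at \<open>z = \<zeta>\<close> is an artefact of division by zero and \<open>ln 0 = 0\<close>;
  it only matters on a null set.\<close>
definition G_kernel :: "nat \<Rightarrow> complex \<Rightarrow> complex \<Rightarrow> real" where
  "G_kernel k z \<zeta> =
     cmod (\<zeta> - z) ^ (2 * (k - 1)) * ln ((cmod ((1 - z * cnj \<zeta>) / (\<zeta> - z)))\<^sup>2)
     + (\<Sum>l = 1..k - 1. (-1) ^ l / real l * cmod (\<zeta> - z) ^ (2 * (k - 1 - l))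
          * (1 - (cmod \<zeta>)\<^sup>2) ^ l * (1 - (cmod z)\<^sup>2) ^ l)"

definition U_weight :: "complex \<Rightarrow> nat \<Rightarrow> complex \<Rightarrow> real" where
  "U_weight \<zeta> k z =
     (-1) ^ (k + 1) * G_kernel k z \<zeta> / ((fact (k - 1))\<^sup>2 * (1 - (cmod \<zeta>)\<^sup>2) ^ k)"

text \<open>No truncation takes place in \<open>ennreal\<close>: see \<open>U_weight_nonneg\<close> below.\<close>
definition D_point :: "complex \<Rightarrow> nat \<Rightarrow> (complex \<Rightarrow> complex) \<Rightarrow> ennreal" where
  "D_point \<zeta> k f =
     (\<integral>\<^sup>+ z. ennreal ((cmod ((deriv ^^ k) f z))\<^sup>2 * U_weight \<zeta> k z) \<partial>disc_area)"

definition D_sigma :: "nat \<Rightarrow> (complex \<Rightarrow> complex) \<Rightarrow> ennreal" where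
  "D_sigma n f =
     (if n = 0 then hardy2_norm_sq f
      else ennreal (1 / (fact n * fact (n - 1))) *
        (\<integral>\<^sup>+ z. ennreal ((cmod ((deriv ^^ n) f z))\<^sup>2 * (1 - (cmod z)\<^sup>2) ^ (n - 1)) \<partial>disc_area))"

definition diff_quotient :: "(complex \<Rightarrow> complex) \<Rightarrow> complex \<Rightarrow> complex \<Rightarrow> complex" where
  "diff_quotient f \<zeta> z = (if z = \<zeta> then deriv f \<zeta> else (f z - f \<zeta>) / (z - \<zeta>))"

lemma diff_quotient_holomorphic:
  assumes "f holomorphic_on unit_disc" and "\<zeta> \<in> unit_disc"
  shows "diff_quotient f \<zeta> holomorphic_on unit_disc"
  using pole_lemma[OF assms(1), of \<zeta>] assms(2)
  by (simp add: diff_quotient_def[abs_def])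

lemma ln_taylor_remainder_sign:
  fixes x :: real
  assumes "x \<ge> 0"
  shows "(-1) ^ n * (ln (1 + x) + (\<Sum>l = 1..n. (-1) ^ l / real l * x ^ l)) \<ge> 0"
proof -
  define F where "F = (\<lambda>x::real. (-1) ^ n * (ln (1 + x) + (\<Sum>l = 1..n. (-1) ^ l / real l * x ^ l)))"
  have alg: "1 / (1 + y) + (\<Sum>l = 1..m. (-1) ^ l * y ^ (l - 1)) = (- y) ^ m / (1 + y)"
    if "y \<ge> 0" for y :: real and m
  proof (induction m)
    case (Suc m)
    have "1 / (1 + y) + (\<Sum>l = 1..Suc m. (-1) ^ l * y ^ (l - 1))
        = (- y) ^ m / (1 + y) + (-1) ^ Suc m * y ^ m"
      using Suc.IH by simp
    also have "\<dots> = (- y) ^ m / (1 + y) - (- y) ^ m"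
      by (simp add: power_minus[of y])
    also have "\<dots> = (- y) ^ Suc m / (1 + y)"
      using that by (simp add: field_simps)
    finally show ?case .
  qed simp
  have der: "(F has_real_derivative y ^ n / (1 + y)) (at y)" if "y \<ge> 0" for y
  proof -
    have "(F has_real_derivative
        (-1) ^ n * (1 / (1 + y) + (\<Sum>l = 1..n. (-1) ^ l / real l * (real l * y ^ (l - 1))))) (at y)"
      unfolding F_def using that by (auto intro!: derivative_eq_intros simp: field_simps)
    also have "(\<Sum>l = 1..n. (-1) ^ l / real l * (real l * y ^ (l - 1)))
        = (\<Sum>l = 1..n. (-1) ^ l * y ^ (l - 1))"
      by (intro sum.cong) auto
    also have "(-1) ^ n * (1 / (1 + y) + \<dots>) = y ^ n / (1 + y)"
      unfolding alg[OF that] by (simp add: power_minus[of y])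
    finally show ?thesis .
  qed
  have "F 0 \<le> F x"
  proof (rule DERIV_nonneg_imp_nondecreasing[OF assms])
    fix y :: real assume "0 \<le> y" "y \<le> x"
    then show "\<exists>d. (F has_real_derivative d) (at y) \<and> 0 \<le> d"
      using der[of y] by (intro exI[of _ "y ^ n / (1 + y)"]) simp
  qed
  moreover have "F 0 = 0"
    by (simp add: F_def power_0_left sum.neutral)
  ultimately show ?thesis
    by (simp add: F_def)
qed

lemma U_weight_nonneg:
  assumes "k \<ge> 1" and z: "z \<in> unit_disc" and zeta: "\<zeta> \<in> unit_disc"
  shows "U_weight \<zeta> k z \<ge> 0"
proof -
  define n where "n = k - 1"
  have k: "k = Suc n" using assms(1) by (simp add: n_def)
  define a where "a = (cmod (\<zeta> - z))\<^sup>2"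
  define b where "b = (1 - (cmod \<zeta>)\<^sup>2) * (1 - (cmod z)\<^sup>2)"
  have zl: "(cmod z)\<^sup>2 < 1" and zetal: "(cmod \<zeta>)\<^sup>2 < 1"
    using z zeta by (simp_all add: abs_square_less_1)
  have b: "b > 0" using zl zetal by (simp add: b_def)
  have ab: "(cmod (1 - z * cnj \<zeta>))\<^sup>2 = a + b"
    unfolding a_def b_def cmod_power2 by (simp add: algebra_simps power2_eq_square)
  have sm: "(-1) ^ l / real l * cmod (\<zeta> - z) ^ (2 * (n - l))
          * (1 - (cmod \<zeta>)\<^sup>2) ^ l * (1 - (cmod z)\<^sup>2) ^ l = (-1) ^ l / real l * a ^ (n - l) * b ^ l" for l
    by (simp add: a_def b_def power_mult power_mult_distrib)
  have G: "G_kernel k z \<zeta> = a ^ n * ln ((a + b) / a)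
      + (\<Sum>l = 1..n. (-1) ^ l / real l * a ^ (n - l) * b ^ l)"
    unfolding G_kernel_def k diff_Suc_1 sm
    by (simp add: norm_divide power_divide ab flip: a_def power_mult)
       (simp add: power_mult a_def)
  have "(-1) ^ n * G_kernel k z \<zeta> \<ge> 0"
  proof (cases "a = 0")
    case True
    have "(\<Sum>l = 1..n. (-1) ^ l / real l * a ^ (n - l) * b ^ l)
        = (\<Sum>l = 1..n. if l = n then (-1) ^ l / real l * b ^ l else 0)"
      using True by (intro sum.cong) auto
    also have "\<dots> = (if n = 0 then 0 else (-1) ^ n / real n * b ^ n)"
      by simp
    finally have "G_kernel k z \<zeta> = (if n = 0 then 0 else (-1) ^ n / real n * b ^ n)"
      unfolding G using True by simp
    then show ?thesis
      using b by (auto simp: field_simps simp flip: power_add mult_2)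
  next
    case False
    then have a: "a > 0" by (simp add: a_def)
    have "(\<Sum>l = 1..n. (-1) ^ l / real l * a ^ (n - l) * b ^ l)
        = (\<Sum>l = 1..n. a ^ n * ((-1) ^ l / real l * (b / a) ^ l))"
      using a by (intro sum.cong) (auto simp: power_diff power_divide)
    then have "G_kernel k z \<zeta>
        = a ^ n * (ln (1 + b / a) + (\<Sum>l = 1..n. (-1) ^ l / real l * (b / a) ^ l))"
      unfolding G using a by (simp add: sum_distrib_left distrib_left add_divide_distrib)
    then have eq: "(-1) ^ n * G_kernel k z \<zeta>
        = a ^ n * ((-1) ^ n * (ln (1 + b / a) + (\<Sum>l = 1..n. (-1) ^ l / real l * (b / a) ^ l)))"
      by (simp only: mult.left_commute)
    show ?thesis
      unfolding eq using a b by (intro mult_nonneg_nonneg ln_taylor_remainder_sign) simp_all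
  qed
  then show ?thesis
    unfolding U_weight_def using zetal by (simp add: k)
qed

end

theory Submission
  imports Defs
begin

text \<open>
  Write \<open>\<phi>(z) = (\<zeta> - z) / (1 - cnj \<zeta> z)\<close> for the involution of the disc that exchanges \<open>0\<close>
  and \<open>\<zeta>\<close>, and put \<open>L(z) = 1 - cnj \<zeta> z\<close> and \<open>c = 1 - |\<zeta>|\<^sup>2\<close>. The proof carries \<open>\<zeta>\<close> to the origin by
  \<open>\<phi>\<close>, and compares Taylor coefficients there.

  Moving the point. Bol's identity (\<open>higher_deriv_involution\<close>) says that the \<open>k\<close>-th derivative of
  \<open>L^(k-1) (f o \<phi>)\<close> is \<open>(-c)^k L^-(k+1) (f^(k) o \<phi>)\<close>: no lower derivatives of \<open>f\<close> appear. After the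
  substitution \<open>z \<mapsto> \<phi>(z)\<close> the powers of \<open>|L|\<close> coming from this identity, from the Jacobian and from
  the weight cancel, whence \<open>D_{\<zeta>,k}(f) = c^-k D_{0,k}(L^(k-1) (f o \<phi>))\<close>
  (\<open>D_point_involution\<close>). In the same way \<open>D_{\<sigma>,n}(F) = c^(1-n) D_{\<sigma>,n}(L^(n-1) (F o \<phi>))\<close>
  (\<open>D_sigma_involution\<close>). For \<open>n = 0\<close> the last formula involves no derivative; it says that
  \<open>F \<mapsto> (F o \<phi>) / L\<close> is, up to a constant, an isometry of \<open>H\<^sup>2\<close>, and it holds because the images
  \<open>\<phi>^j / L\<close> of the monomials are orthogonal on the circle (\<open>malmquist_orthogonal\<close>). Both sides of
  the theorem ignore the constant \<open>f(\<zeta>)\<close>. Once it is subtracted, the operator for \<open>n = k - 1\<close> turns the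
  difference quotient of \<open>f\<close> at \<open>\<zeta>\<close> into \<open>-1/c\<close> times the difference quotient of \<open>L^(k-1) (f o \<phi>)\<close> at
  the origin (\<open>diff_quotient_involution\<close>), and the powers of \<open>c\<close> agree.

  At the origin. All weights are radial there, so an average over rotations and Parseval's
  identity turn each integral into a sum of \<open>|a_m|\<^sup>2\<close> times the \<open>m\<close>-th moment of the weight in the
  variable \<open>t = |z|\<^sup>2\<close>, where \<open>a_m\<close> are Taylor coefficients (\<open>nn_integral_disc_area_taylor\<close>). The moments of
  \<open>(1 - t)^(n-1)\<close> are values of the beta function, and those of the logarithmic weight follow from a
  recursion in its order (\<open>has_integral_power_log_remainder\<close>). The difference quotient at the origin
  merely shifts the coefficients, and the two sums agree term by term
  (\<open>D_point_0_eq_D_sigma\<close>).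
\<close>

section \<open>Holomorphic substitutions in the disc\<close>

text \<open>Matrices and determinants live on \<open>real^2\<close>; this identification carries the Jacobian formula
  over to the plane.\<close>
definition complex_of_vec :: "real^2 \<Rightarrow> complex" where
  "complex_of_vec v = Complex (v $ 1) (v $ 2)"

definition vec_of_complex :: "complex \<Rightarrow> real^2" where
  "vec_of_complex z = vector [Re z, Im z]"

lemma complex_of_vec_of_complex [simp]: "complex_of_vec (vec_of_complex z) = z"
  by (simp add: complex_of_vec_def vec_of_complex_def)

lemma vec_of_complex_of_vec [simp]: "vec_of_complex (complex_of_vec v) = v"
  by (simp add: complex_of_vec_def vec_of_complex_def vec_eq_iff forall_2)

lemma bounded_linear_complex_of_vec: "bounded_linear complex_of_vec"
  unfolding linear_conv_bounded_linear[symmetric] linear_iff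
  by (simp add: complex_of_vec_def complex_eq_iff)

lemma bounded_linear_vec_of_complex: "bounded_linear vec_of_complex"
  unfolding linear_conv_bounded_linear[symmetric] linear_iff
  by (simp add: vec_of_complex_def vec_eq_iff forall_2)

lemma measurable_complex_of_vec [measurable]: "complex_of_vec \<in> borel_measurable borel"
  using bounded_linear_complex_of_vec
  by (intro borel_measurable_continuous_onI linear_continuous_on)

text \<open>Boxes correspond to boxes of the same volume, and volumes of boxes determine Lebesgue measure.\<close>
lemma lborel_complex_eq_distr: "(lborel :: complex measure) = distr lborel borel complex_of_vec"
proof (rule lborel_eqI)
  fix l u :: complex
  assume le: "\<And>b. b \<in> Basis \<Longrightarrow> l \<bullet> b \<le> u \<bullet> b"
  have "complex_of_vec -` box l u = box (vec_of_complex l) (vec_of_complex u)"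
    by (auto simp: complex_of_vec_def vec_of_complex_def box_complex_eq mem_box_cart forall_2
        in_box_complex_iff)
  moreover have "(\<Prod>b\<in>Basis. (vec_of_complex u - vec_of_complex l) \<bullet> b) = (\<Prod>b\<in>Basis. (u - l) \<bullet> b)"
    by (simp add: Basis_complex_def Basis_vec_def UNION_singleton_eq_range prod.reindex
        inj_on_def axis_eq_axis inner_axis UNIV_2 vec_of_complex_def)
  moreover have "\<forall>b\<in>Basis. vec_of_complex l \<bullet> b \<le> vec_of_complex u \<bullet> b"
    using le[of 1] le[of \<i>]
    by (auto simp: Basis_vec_def inner_axis vec_of_complex_def forall_2 Basis_complex_def UNIV_2)
  ultimately show "emeasure (distr lborel borel complex_of_vec) (box l u) = ennreal (\<Prod>b\<in>Basis. (u - l) \<bullet> b)"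
    by (simp add: emeasure_distr emeasure_lborel_box)
qed simp

text \<open>The Jacobian determinant of a holomorphic map is the squared modulus of its derivative.\<close>
lemma det_matrix_mult_complex:
  "det (matrix (\<lambda>v. vec_of_complex (d * complex_of_vec v))) = (cmod d)\<^sup>2"
  unfolding cmod_power2
  by (simp add: det_2 matrix_def vec_of_complex_def complex_of_vec_def axis_def power2_eq_square)

text \<open>A bounded image has finite measure, and the change of variables theorem then yields both the
  existence and the value of the Jacobian integral.\<close>
lemma emeasure_holomorphic_image:
  fixes g :: "complex \<Rightarrow> complex"
  assumes hol: "g holomorphic_on S" and S: "open S" and inj: "inj_on g S"
    and A: "A \<in> sets borel" "A \<subseteq> S" and B: "g ` A \<in> sets borel" "bounded (g ` A)"
  shows "emeasure lborel (g ` A) = (\<integral>\<^sup>+z. ennreal ((cmod (deriv g z))\<^sup>2) * indicator A z \<partial>lborel)"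
proof -
  define h where "h = vec_of_complex \<circ> g \<circ> complex_of_vec"
  define A' where "A' = complex_of_vec -` A"
  have A'[measurable]: "A' \<in> sets borel"
    unfolding A'_def using A(1) by (metis measurable_complex_of_vec measurable_sets_borel)
  have img: "h ` A' = complex_of_vec -` (g ` A)"
  proof (intro set_eqI iffI)
    fix v assume "v \<in> complex_of_vec -` (g ` A)"
    then obtain z where "z \<in> A" "complex_of_vec v = g z" by auto
    then have "vec_of_complex z \<in> A'" "v = h (vec_of_complex z)"
      by (simp_all add: A'_def h_def flip: \<open>complex_of_vec v = g z\<close>)
    then show "v \<in> h ` A'" by blast
  qed (auto simp: h_def A'_def)
  have der: "(h has_derivative (\<lambda>v. vec_of_complex (deriv g (complex_of_vec x) * complex_of_vec v)))
      (at x within A')" if "x \<in> A'" for x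
  proof -
    have "complex_of_vec x \<in> S" using that A(2) by (auto simp: A'_def)
    then have "(g has_field_derivative deriv g (complex_of_vec x)) (at (complex_of_vec x))"
      by (rule holomorphic_derivI[OF hol S])
    then have "(g has_derivative (*) (deriv g (complex_of_vec x))) (at (complex_of_vec x))"
      by (simp add: has_field_derivative_def)
    moreover have "(complex_of_vec has_derivative complex_of_vec) (at x)"
      using bounded_linear_complex_of_vec by (rule bounded_linear_imp_has_derivative)
    ultimately have "(g \<circ> complex_of_vec has_derivative (*) (deriv g (complex_of_vec x)) \<circ> complex_of_vec) (at x)"
      using diff_chain_at by blast
    moreover have "(vec_of_complex has_derivative vec_of_complex) (at ((g \<circ> complex_of_vec) x))"
      using bounded_linear_vec_of_complex by (rule bounded_linear_imp_has_derivative)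
    ultimately have "(vec_of_complex \<circ> (g \<circ> complex_of_vec) has_derivative
       vec_of_complex \<circ> ((*) (deriv g (complex_of_vec x)) \<circ> complex_of_vec)) (at x)"
      using diff_chain_at by blast
    from has_derivative_at_withinI[OF this] show ?thesis
      unfolding h_def o_def .
  qed
  have inj': "inj_on h A'"
  proof (rule inj_onI)
    fix x y assume *: "x \<in> A'" "y \<in> A'" "h x = h y"
    then have "complex_of_vec (h x) = complex_of_vec (h y)" by simp
    then have "g (complex_of_vec x) = g (complex_of_vec y)"
      by (simp add: h_def)
    then have "complex_of_vec x = complex_of_vec y"
      using inj * A(2) by (auto simp: A'_def inj_on_def)
    then have "vec_of_complex (complex_of_vec x) = vec_of_complex (complex_of_vec y)" by simp
    then show "x = y" by simp
  qed
  have img_borel: "h ` A' \<in> sets borel"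
    unfolding img using B(1) by (metis measurable_complex_of_vec measurable_sets_borel)
  have bnd: "bounded (h ` A')"
  proof -
    have "h ` A' = vec_of_complex ` (g ` A)"
    proof (intro set_eqI iffI)
      fix v assume "v \<in> h ` A'"
      then have "complex_of_vec v \<in> g ` A" by (simp add: img)
      then have "vec_of_complex (complex_of_vec v) \<in> vec_of_complex ` (g ` A)" by (rule imageI)
      then show "v \<in> vec_of_complex ` (g ` A)" by simp
    qed (auto simp: img)
    then show ?thesis
      using bounded_linear_image[OF B(2) bounded_linear_vec_of_complex] by simp
  qed
  have meas: "h ` A' \<in> lmeasurable"
    using img_borel bnd by (metis bounded_set_imp_lmeasurable sets_completionI_sets sets_lborel)
  have "((\<lambda>x. \<bar>det (matrix (\<lambda>v. vec_of_complex (deriv g (complex_of_vec x) * complex_of_vec v)))\<bar>)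
      has_integral measure lebesgue (h ` A')) A'"
    using has_measure_differentiable_image[OF _ der inj'] meas A' by auto
  then have *: "((\<lambda>x. (cmod (deriv g (complex_of_vec x)))\<^sup>2) has_integral measure lebesgue (h ` A')) A'"
    by (simp add: det_matrix_mult_complex)
  have "emeasure lborel (g ` A) = emeasure lborel (h ` A')"
    using B(1) by (subst lborel_complex_eq_distr) (simp add: emeasure_distr img)
  also have "\<dots> = ennreal (measure lebesgue (h ` A'))"
    using meas img_borel by (simp add: fmeasurable_def emeasure_eq_ennreal_measure less_top)
  also have "\<dots> = (\<integral>\<^sup>+x. ennreal ((cmod (deriv g (complex_of_vec x)))\<^sup>2) * indicator A' x \<partial>lborel)"
    by (rule nn_integral_has_integral_lebesgue'[OF _ *, symmetric]) simp
  also have "\<dots> = (\<integral>\<^sup>+x. (\<lambda>z. ennreal ((cmod (deriv g z))\<^sup>2) * indicator A z) (complex_of_vec x) \<partial>lborel)"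
    by (simp add: A'_def indicator_def)
  also have "\<dots> = (\<integral>\<^sup>+z. ennreal ((cmod (deriv g z))\<^sup>2) * indicator A z \<partial>lborel)"
  proof (subst lborel_complex_eq_distr, rule nn_integral_distr[symmetric])
    have "(\<lambda>z. ennreal ((cmod (deriv g z))\<^sup>2)) \<in> borel_measurable (restrict_space borel A)"
      using hol S A by (intro measurable_compose[OF _ measurable_ennreal]
       borel_measurable_continuous_on_restrict continuous_intros holomorphic_on_imp_continuous_on)
        (meson holomorphic_deriv holomorphic_on_subset)
    then show "(\<lambda>z. ennreal ((cmod (deriv g z))\<^sup>2) * indicator A z) \<in> borel_measurable (distr lborel borel complex_of_vec)"
      using A(1) by (subst (asm) borel_measurable_restrict_space_iff_ennreal) (simp_all)
  qed simp
  finally show ?thesis .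
qed

lemma sets_disc_area: "sets disc_area = sets (restrict_space borel unit_disc)"
  by (simp add: disc_area_def sets_restrict_space)

lemma space_disc_area [simp]: "space disc_area = unit_disc"
  by (simp add: disc_area_def space_restrict_space space_scale_measure)

lemma nn_integral_disc_area:
  assumes "h \<in> borel_measurable disc_area"
  shows "(\<integral>\<^sup>+z. h z \<partial>disc_area) = ennreal (1 / pi) * (\<integral>\<^sup>+z. h z * indicator unit_disc z \<partial>lborel)"
proof -
  have "h \<in> borel_measurable (restrict_space lborel unit_disc)"
    using assms by (simp add: disc_area_def cong: measurable_cong_sets)
  then show ?thesis
   by (simp add: disc_area_def nn_integral_scale_measure nn_integral_restrict_space mult.commute)
qed

lemma emeasure_disc_area:
  assumes "A \<in> sets borel" "A \<subseteq> unit_disc"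
  shows "emeasure disc_area A = ennreal (1 / pi) * emeasure lborel A"
  using assms by (simp add: disc_area_def emeasure_restrict_space)

lemma holomorphic_measurable_disc_area:
  "g holomorphic_on unit_disc \<Longrightarrow> g \<in> borel_measurable disc_area"
  using borel_measurable_continuous_on_restrict[of unit_disc g] holomorphic_on_imp_continuous_on
  by (simp add: sets_disc_area cong: measurable_cong_sets)

text \<open>The area measure and the push-forward of \<open>|g'|\<^sup>2 dA\<close> under \<open>g\<close> give the same mass to every Borel
  set, by the area formula for holomorphic images.\<close>
lemma nn_integral_disc_area_substitution:
  assumes hol: "g holomorphic_on unit_disc" and inj: "inj_on g unit_disc" and img: "g ` unit_disc = unit_disc"
    and h: "h \<in> borel_measurable disc_area"
  shows "(\<integral>\<^sup>+z. h z \<partial>disc_area) = (\<integral>\<^sup>+z. ennreal ((cmod (deriv g z))\<^sup>2) * h (g z) \<partial>disc_area)"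
proof -
  define d where "d = (\<lambda>z. ennreal ((cmod (deriv g z))\<^sup>2))"
  have d: "d \<in> borel_measurable disc_area"
    unfolding d_def using holomorphic_measurable_disc_area[OF holomorphic_deriv[OF hol open_ball]] by simp
  have g: "g \<in> measurable disc_area disc_area"
  proof -
    have "g \<in> measurable disc_area (restrict_space borel unit_disc)"
      using holomorphic_measurable_disc_area[OF hol] img
      by (intro measurable_restrict_space2) auto
    then show ?thesis by (simp add: sets_disc_area cong: measurable_cong_sets)
  qed
  have "disc_area = distr (density disc_area d) disc_area g"
  proof (rule measure_eqI)
    fix A assume "A \<in> sets disc_area"
    then have A: "A \<in> sets borel" "A \<subseteq> unit_disc"
      by (auto simp: sets_disc_area sets_restrict_space_iff)
    define B where "B = g -` A \<inter> unit_disc"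
    have B: "B \<in> sets disc_area"
      using measurable_sets[OF g \<open>A \<in> sets disc_area\<close>] by (simp add: B_def)
    then have B': "B \<in> sets borel" "B \<subseteq> unit_disc"
      by (auto simp: sets_disc_area sets_restrict_space_iff)
    have gB: "g ` B = A"
    proof
      show "g ` B \<subseteq> A" by (auto simp: B_def)
      show "A \<subseteq> g ` B"
      proof
        fix w assume "w \<in> A"
        then have "w \<in> g ` unit_disc" using A(2) unfolding img by (rule rev_subsetD)
        with \<open>w \<in> A\<close> show "w \<in> g ` B" unfolding B_def by blast
      qed
    qed
    have "emeasure (distr (density disc_area d) disc_area g) A = emeasure (density disc_area d) B"
      using g \<open>A \<in> sets disc_area\<close> by (subst emeasure_distr) (auto simp: B_def)
    also have "\<dots> = (\<integral>\<^sup>+z. d z * indicator B z \<partial>disc_area)"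
      using d B by (rule emeasure_density)
    also have "\<dots> = ennreal (1 / pi) * (\<integral>\<^sup>+z. d z * indicator B z * indicator unit_disc z \<partial>lborel)"
      using d B by (intro nn_integral_disc_area) auto
    also have "(\<integral>\<^sup>+z. d z * indicator B z * indicator unit_disc z \<partial>lborel)
        = (\<integral>\<^sup>+z. d z * indicator B z \<partial>lborel)"
      using B'(2) by (intro nn_integral_cong) (auto split: split_indicator)
    also have "\<dots> = emeasure lborel A"
      unfolding d_def using emeasure_holomorphic_image[OF hol open_ball inj B'] A gB bounded_subset[OF bounded_ball A(2)]
      by simp
    finally show "emeasure disc_area A = emeasure (distr (density disc_area d) disc_area g) A"
      using A by (simp add: emeasure_disc_area)
  qed simp
  then have "(\<integral>\<^sup>+z. h z \<partial>disc_area) = (\<integral>\<^sup>+z. h z \<partial>(distr (density disc_area d) disc_area g))"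
    by simp
  also have "\<dots> = (\<integral>\<^sup>+z. h (g z) \<partial>(density disc_area d))"
    using g h by (intro nn_integral_distr) auto
  also have "\<dots> = (\<integral>\<^sup>+z. d z * h (g z) \<partial>disc_area)"
    using d measurable_compose[OF g h] by (intro nn_integral_density) auto
  finally show ?thesis by (simp add: d_def)
qed

section \<open>The involution of the disc\<close>

text \<open>The automorphism of the disc that exchanges \<open>0\<close> and \<open>a\<close>. The sign makes it its own inverse.\<close>
definition disc_involution :: "complex \<Rightarrow> complex \<Rightarrow> complex" where
  "disc_involution a z = (a - z) / (1 - cnj a * z)"

lemma involution_denominator_nonzero:
  assumes "cmod a < 1" "cmod z \<le> 1"
  shows "1 - cnj a * z \<noteq> 0"
proof
  assume "1 - cnj a * z = 0"
  then have "cmod (cnj a * z) = 1" by (metis eq_iff_diff_eq_0 norm_one)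
  then have "cmod a * cmod z = 1" by (simp add: norm_mult)
  then show False
    using assms by (metis mult_left_le norm_ge_zero not_le)
qed

lemma one_minus_cmod_disc_involution:
  assumes "cmod a < 1" "cmod z \<le> 1"
  shows "1 - (cmod (disc_involution a z))\<^sup>2
    = (1 - (cmod a)\<^sup>2) * (1 - (cmod z)\<^sup>2) / (cmod (1 - cnj a * z))\<^sup>2"
proof -
  have "(cmod (1 - cnj a * z))\<^sup>2 - (cmod (a - z))\<^sup>2 = (1 - (cmod a)\<^sup>2) * (1 - (cmod z)\<^sup>2)"
    unfolding cmod_power2 by (simp add: algebra_simps power2_eq_square)
  then show ?thesis
    using involution_denominator_nonzero[OF assms]
    by (simp add: disc_involution_def norm_divide power_divide field_simps)
qed

lemma disc_involution_on_circle:
  assumes "cmod a < 1" "cmod z = 1"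
  shows "cmod (disc_involution a z) = 1"
  using one_minus_cmod_disc_involution[of a z] assms norm_ge_zero[of "disc_involution a z"]
  by (auto simp: power2_eq_1_iff simp del: norm_ge_zero)

lemma disc_involution_in_disc:
  assumes "cmod a < 1" "cmod z < 1"
  shows "cmod (disc_involution a z) < 1"
proof -
  have "0 < (1 - (cmod a)\<^sup>2) * (1 - (cmod z)\<^sup>2) / (cmod (1 - cnj a * z))\<^sup>2"
    using assms involution_denominator_nonzero[of a z] 
    by (intro divide_pos_pos mult_pos_pos) (auto simp: abs_square_less_1)
  then have "(cmod (disc_involution a z))\<^sup>2 < 1"
    using one_minus_cmod_disc_involution[of a z] assms by simp
  then show ?thesis by (simp add: abs_square_less_1)
qed

lemma disc_involution_0 [simp]: "disc_involution a 0 = a"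
  and disc_involution_self [simp]: "disc_involution a a = 0"
  by (simp_all add: disc_involution_def)

lemma of_real_one_minus_cmod_sq: "complex_of_real (1 - (cmod a)\<^sup>2) = 1 - a * cnj a"
  by (simp only: of_real_diff of_real_1 complex_norm_square)

lemma involution_denominator_compose:
  assumes "cmod a < 1" "cmod z < 1"
  shows "(1 - cnj a * disc_involution a z) * (1 - cnj a * z) = of_real (1 - (cmod a)\<^sup>2)"
  using involution_denominator_nonzero[of a z] assms unfolding of_real_one_minus_cmod_sq
  by (simp add: disc_involution_def field_simps)

lemma disc_involution_involutive:
  assumes "cmod a < 1" "cmod z < 1"
  shows "disc_involution a (disc_involution a z) = z"
proof -
  have c: "of_real (1 - (cmod a)\<^sup>2) \<noteq> (0::complex)"
    using assms abs_square_less_1[of "cmod a"] unfolding of_real_eq_0_iff by simp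
  have "(a - disc_involution a z) * (1 - cnj a * z) = z * of_real (1 - (cmod a)\<^sup>2)"
    using involution_denominator_nonzero[of a z] assms unfolding of_real_one_minus_cmod_sq
    by (simp add: disc_involution_def field_simps)
  also have "\<dots> = z * ((1 - cnj a * disc_involution a z) * (1 - cnj a * z))"
    using assms by (simp only: involution_denominator_compose)
  finally have "a - disc_involution a z = z * (1 - cnj a * disc_involution a z)"
    using involution_denominator_nonzero[of a z] assms by simp
  moreover have "1 - cnj a * disc_involution a z \<noteq> 0"
    using involution_denominator_compose[OF assms] c by auto
  ultimately show ?thesis
    by (simp add: disc_involution_def[of a "disc_involution a z"])
qed

lemma holomorphic_on_disc_involution:
  assumes "cmod a < 1"
  shows "disc_involution a holomorphic_on cball 0 1"
  unfolding disc_involution_def using involution_denominator_nonzero[OF assms]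
  by (intro holomorphic_intros) auto

lemma inj_on_disc_involution: "cmod a < 1 \<Longrightarrow> inj_on (disc_involution a) unit_disc"
  by (rule inj_on_inverseI[of _ "disc_involution a"]) (simp add: disc_involution_involutive)

lemma image_disc_involution:
  assumes "cmod a < 1"
  shows "disc_involution a ` unit_disc = unit_disc"
proof
  show "disc_involution a ` unit_disc \<subseteq> unit_disc"
    using assms by (auto simp: disc_involution_in_disc)
  show "unit_disc \<subseteq> disc_involution a ` unit_disc"
  proof
    fix z :: complex assume "z \<in> unit_disc"
    then have "z = disc_involution a (disc_involution a z)" "disc_involution a z \<in> unit_disc"
      using assms by (simp_all add: disc_involution_involutive disc_involution_in_disc)
    then show "z \<in> disc_involution a ` unit_disc" by (rule image_eqI)
  qed
qed

section \<open>Orthogonality on the circle\<close>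

lemma cis_measurable:
  "cis \<in> measurable (scale_measure c (restrict_space lborel {0..2 * pi})) borel"
proof -
  have "cis \<in> borel_measurable lborel"
    by (simp add: borel_measurable_continuous_onI continuous_intros)
  then have "cis \<in> borel_measurable (restrict_space lborel {0..2 * pi})"
    by (rule measurable_restrict_space1)
  then show ?thesis
    by (simp cong: measurable_cong_sets)
qed

lemma AE_circle_arclen: "AE w in circle_arclen. cmod w = 1"
  unfolding circle_arclen_def using cis_measurable by (subst AE_distr_iff) auto

text \<open>Nothing is known about \<open>f\<close> off the circle, not even measurability. The proof passes to the
  restriction of \<open>f\<close> to the circle, which carries all the mass.\<close>
lemma nn_integral_circle_arclen:
  fixes f :: "complex \<Rightarrow> real"
  assumes cont: "continuous_on (sphere 0 1) f" and nonneg: "\<And>w. cmod w = 1 \<Longrightarrow> f w \<ge> 0"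
    and I: "((\<lambda>t. f (cis t)) has_integral I) {0..2 * pi}"
  shows "(\<integral>\<^sup>+w. ennreal (f w) \<partial>circle_arclen) = ennreal (I / (2 * pi))"
proof -
  let ?M = "restrict_space lborel {0..2 * pi} :: real measure"
  define g where "g = (\<lambda>w. ennreal (f w) * indicator (sphere 0 1) w)"
  have "f \<in> borel_measurable (restrict_space borel (sphere 0 1))"
    using cont by (rule borel_measurable_continuous_on_restrict)
  then have "(\<lambda>w. ennreal (f w)) \<in> borel_measurable (restrict_space borel (sphere 0 1))"
    by simp
  then have g: "g \<in> borel_measurable borel"
    unfolding g_def by (subst (asm) borel_measurable_restrict_space_iff_ennreal) auto
  have cis: "cis \<in> borel_measurable borel"
    by (intro borel_measurable_continuous_onI continuous_intros)
  have "(\<integral>\<^sup>+w. ennreal (f w) \<partial>circle_arclen) = (\<integral>\<^sup>+w. g w \<partial>circle_arclen)"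
    by (rule nn_integral_cong_AE[OF AE_mp[OF AE_circle_arclen AE_I2]]) (simp add: g_def)
  also have "\<dots> = (\<integral>\<^sup>+t. g (cis t) \<partial>scale_measure (ennreal (1 / (2 * pi))) ?M)"
    unfolding circle_arclen_def using cis_measurable g by (intro nn_integral_distr) auto
  also have "\<dots> = ennreal (1 / (2 * pi)) * (\<integral>\<^sup>+t. g (cis t) \<partial>?M)"
    using measurable_compose[OF cis g]
    by (intro nn_integral_scale_measure measurable_restrict_space1) auto
  also have "(\<integral>\<^sup>+t. g (cis t) \<partial>?M) = (\<integral>\<^sup>+t. ennreal (f (cis t)) * indicator {0..2 * pi} t \<partial>lborel)"
    by (subst nn_integral_restrict_space) (auto simp: g_def intro!: nn_integral_cong split: split_indicator)
  also have "\<dots> = ennreal I"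
    using nonneg by (intro nn_integral_has_integral_lebesgue' I) simp
  also have "ennreal (1 / (2 * pi)) * ennreal I = ennreal (I / (2 * pi))"
    using has_integral_nonneg[OF I] nonneg by (subst ennreal_mult[symmetric]) auto
  finally show ?thesis .
qed

text \<open>The image of the monomial \<open>z^j\<close> under \<open>F \<mapsto> (F o \<phi>) / (1 - cnj a z)\<close>, where \<open>\<phi>\<close> is the involution;
  these are the Takenaka-Malmquist functions whose poles all coincide.\<close>
definition malmquist :: "complex \<Rightarrow> nat \<Rightarrow> complex \<Rightarrow> complex" where
  "malmquist a j z = disc_involution a z ^ j / (1 - cnj a * z)"

text \<open>For \<open>|w| = 1\<close> one has \<open>|\<phi>(w)| = 1\<close> and \<open>|1 - cnj a w|\<^sup>2 = (1 - cnj a w) (w - a) / w\<close>. For \<open>j \<le> i\<close> the integrand is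
  therefore the holomorphic function \<open>F = \<phi>^(i-j) / (1 - cnj a w)\<close> times the Cauchy kernel at \<open>a\<close>, and
  \<open>F(a) = 0\<close> unless \<open>i = j\<close>, because \<open>\<phi>(a) = 0\<close>.\<close>
lemma malmquist_orthogonal_aux:
  assumes a: "cmod a < 1" and "j \<le> i"
  shows "((\<lambda>t. malmquist a i (cis t) * cnj (malmquist a j (cis t)))
      has_integral (if i = j then 2 * pi / (1 - (cmod a)\<^sup>2) else 0)) {0..2 * pi}"
proof -
  define F where "F = malmquist a (i - j)"
  have "F holomorphic_on cball 0 1"
    unfolding F_def malmquist_def using involution_denominator_nonzero[OF a]
    by (intro holomorphic_intros holomorphic_on_disc_involution a) auto
  then have "((\<lambda>u. F u / (u - a)) has_contour_integral (2 * of_real pi * \<i> * F a)) (circlepath 0 1)"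
    using a by (intro Cauchy_integral_circlepath_simple) auto
  then have "((\<lambda>t. F (cis t) / (cis t - a) * \<i> * cis t) has_integral (2 * of_real pi * \<i> * F a)) {0..2 * pi}"
    unfolding circlepath_def by (subst (asm) has_contour_integral_part_circlepath_iff) auto
  from has_integral_mult_left[OF this, of "- \<i>"]
  have "((\<lambda>t. F (cis t) / (cis t - a) * cis t) has_integral (2 * of_real pi * F a)) {0..2 * pi}"
    by (simp add: mult_ac)
  moreover have "F (cis t) / (cis t - a) * cis t = malmquist a i (cis t) * cnj (malmquist a j (cis t))" for t
  proof -
    define w where "w = cis t"
    have w: "w * cnj w = 1" "cmod w = 1" by (simp_all add: w_def cis_cnj cis_mult)
    have nz: "1 - cnj a * w \<noteq> 0" using involution_denominator_nonzero[of a w] a w by simp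
    have "w * cnj (1 - cnj a * w) = w - a * (w * cnj w)" by (simp add: algebra_simps)
    then have 1: "w * cnj (1 - cnj a * w) = w - a" by (simp add: w)
    have "w \<noteq> 0" using w by auto
    have 2: "disc_involution a w * cnj (disc_involution a w) = 1"
      using disc_involution_on_circle[of a w] a w by (simp add: complex_norm_square[symmetric])
    have "malmquist a i w * cnj (malmquist a j w)
       = disc_involution a w ^ (i - j) * (disc_involution a w * cnj (disc_involution a w)) ^ j
        / ((1 - cnj a * w) * cnj (1 - cnj a * w))"
      using \<open>j \<le> i\<close> by (simp add: malmquist_def power_mult_distrib flip: power_add)
    also have "\<dots> = F w / cnj (1 - cnj a * w)"
      by (simp add: 2 F_def malmquist_def)
    also have "\<dots> = F w / (w - a) * w"
      using \<open>w \<noteq> 0\<close> nz unfolding 1[symmetric] by simp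
    finally show ?thesis by (simp add: w_def)
  qed
  moreover have "2 * pi * F a = (if i = j then 2 * pi / (1 - (cmod a)\<^sup>2) else 0)"
  proof -
    have "1 - cnj a * a = complex_of_real (1 - (cmod a)\<^sup>2)"
      unfolding of_real_one_minus_cmod_sq by (simp add: mult.commute)
    then have "F a = (if i = j then 1 / complex_of_real (1 - (cmod a)\<^sup>2) else 0)"
      using \<open>j \<le> i\<close> by (simp add: F_def malmquist_def)
    then show ?thesis by simp
  qed
  ultimately show ?thesis by simp
qed

text \<open>The case \<open>i < j\<close> is the complex conjugate of the case \<open>j < i\<close>.\<close>
lemma malmquist_orthogonal:
  assumes a: "cmod a < 1"
  shows "((\<lambda>t. malmquist a i (cis t) * cnj (malmquist a j (cis t)))
      has_integral (if i = j then 2 * pi / (1 - (cmod a)\<^sup>2) else 0)) {0..2 * pi}"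
proof (cases "j \<le> i")
  case False
  then have "((\<lambda>t. malmquist a j (cis t) * cnj (malmquist a i (cis t))) has_integral 0) {0..2 * pi}"
    using malmquist_orthogonal_aux[OF a, of i j] by simp
  from has_integral_linear[OF this bounded_linear_cnj] False show ?thesis
    by (simp add: o_def mult.commute)
qed (use malmquist_orthogonal_aux[OF a] in auto)

lemma nn_integral_circle_malmquist_sum:
  assumes a: "cmod a < 1"
  shows "(\<integral>\<^sup>+w. ennreal ((cmod (\<Sum>j<N. c j * malmquist a j w))\<^sup>2) \<partial>circle_arclen)
     = ennreal ((\<Sum>j<N. (cmod (c j))\<^sup>2) / (1 - (cmod a)\<^sup>2))"
proof -
  let ?K = "1 - (cmod a)\<^sup>2"
  define S where "S = (\<lambda>w. \<Sum>j<N. c j * malmquist a j w)"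
  have cont: "continuous_on (sphere 0 1) S"
  proof -
    have "S holomorphic_on cball 0 1"
      unfolding S_def malmquist_def using involution_denominator_nonzero[OF a]
      by (intro holomorphic_intros holomorphic_on_disc_involution a) auto
    then show ?thesis
      by (meson continuous_on_subset holomorphic_on_imp_continuous_on sphere_cball)
  qed
  have "((\<lambda>t. \<Sum>i<N. \<Sum>j<N. c i * cnj (c j) * (malmquist a i (cis t) * cnj (malmquist a j (cis t))))
     has_integral (\<Sum>i<N. \<Sum>j<N. c i * cnj (c j) * (if i = j then 2 * pi / ?K else 0))) {0..2 * pi}"
    using malmquist_orthogonal[OF a] by (intro has_integral_sum has_integral_mult_right finite_lessThan)
  also have "(\<lambda>t. \<Sum>i<N. \<Sum>j<N. c i * cnj (c j) * (malmquist a i (cis t) * cnj (malmquist a j (cis t))))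
      = (\<lambda>t. complex_of_real ((cmod (S (cis t)))\<^sup>2))"
    unfolding complex_norm_square S_def cnj_sum sum_product by (simp add: mult_ac)
  also have "(\<Sum>i<N. \<Sum>j<N. c i * cnj (c j) * (if i = j then 2 * pi / ?K else 0))
     = (\<Sum>i<N. c i * cnj (c i) * (2 * pi / ?K))"
    by (intro sum.cong refl) (simp add: if_distrib[of complex_of_real] if_distrib[of "\<lambda>x. _ * x"] cong: if_cong)
  also have "\<dots> = complex_of_real ((\<Sum>j<N. (cmod (c j))\<^sup>2) / ?K * (2 * pi))"
    unfolding complex_norm_square[symmetric] of_real_mult of_real_sum of_real_divide
    by (simp add: sum_distrib_left sum_distrib_right sum_divide_distrib mult_ac)
  finally have "((\<lambda>t. Re (complex_of_real ((cmod (S (cis t)))\<^sup>2)))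
      has_integral Re (complex_of_real ((\<Sum>j<N. (cmod (c j))\<^sup>2) / ?K * (2 * pi)))) {0..2 * pi}"
    by (rule has_integral_Re)
  then have "((\<lambda>t. (cmod (S (cis t)))\<^sup>2) has_integral ((\<Sum>j<N. (cmod (c j))\<^sup>2) / ?K * (2 * pi))) {0..2 * pi}"
    by (simp only: Re_complex_of_real)
  then have "(\<integral>\<^sup>+w. ennreal ((cmod (S w))\<^sup>2) \<partial>circle_arclen) = ennreal ((\<Sum>j<N. (cmod (c j))\<^sup>2) / ?K * (2 * pi) / (2 * pi))"
    by (intro nn_integral_circle_arclen continuous_intros cont) auto
  then show ?thesis by (simp add: S_def)
qed

lemma sets_circle_arclen [measurable_cong]: "sets circle_arclen = sets borel"
  by (simp add: circle_arclen_def)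

lemma space_circle_arclen [simp]: "space circle_arclen = UNIV"
  by (simp add: circle_arclen_def)

lemma emeasure_circle_arclen_UNIV: "emeasure circle_arclen UNIV = 1"
proof -
  have "((\<lambda>t. 1::real) has_integral 2 * pi) {0..2 * pi}"
    using has_integral_const_real[of "1::real" 0 "2 * pi"] by simp
  from nn_integral_circle_arclen[OF _ _ this] show ?thesis
    by (simp add: continuous_on_const nn_integral_const)
qed

section \<open>Integral means and Taylor coefficients\<close>

text \<open>Parseval's identity. For \<open>a = 0\<close> the Malmquist functions are the monomials up to sign, which
  settles the partial sums; absolute summability provides a constant bound for dominated convergence.\<close>
lemma nn_integral_circle_power_series:
  fixes c :: "nat \<Rightarrow> complex"
  assumes c: "summable (\<lambda>j. cmod (c j))"
  shows "(\<integral>\<^sup>+w. ennreal ((cmod (\<Sum>j. c j * w ^ j))\<^sup>2) \<partial>circle_arclen) = (\<Sum>j. ennreal ((cmod (c j))\<^sup>2))"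
proof -
  let ?P = "\<lambda>N w. \<Sum>j<N. c j * w ^ j"
  have partial: "(\<integral>\<^sup>+w. ennreal ((cmod (?P N w))\<^sup>2) \<partial>circle_arclen) = (\<Sum>j<N. ennreal ((cmod (c j))\<^sup>2))" for N
  proof -
    have "?P N w = (\<Sum>j<N. (c j * (-1) ^ j) * malmquist 0 j w)" for w
      by (intro sum.cong refl) (simp add: malmquist_def disc_involution_def flip: power_mult_distrib)
    then show ?thesis
      using nn_integral_circle_malmquist_sum[of 0 "\<lambda>j. c j * (-1) ^ j" N]
      by (simp add: norm_mult norm_power)
  qed
  have "(\<lambda>N. \<integral>\<^sup>+w. ennreal ((cmod (?P N w))\<^sup>2) \<partial>circle_arclen)
      \<longlonglongrightarrow> (\<integral>\<^sup>+w. ennreal ((cmod (\<Sum>j. c j * w ^ j))\<^sup>2) \<partial>circle_arclen)"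
  proof (rule nn_integral_dominated_convergence[where w = "\<lambda>_. ennreal ((\<Sum>j. cmod (c j))\<^sup>2)"])
    show "AE w in circle_arclen. ennreal ((cmod (?P N w))\<^sup>2) \<le> ennreal ((\<Sum>j. cmod (c j))\<^sup>2)" for N
      using AE_circle_arclen
    proof eventually_elim
      case (elim w)
      have "cmod (?P N w) \<le> (\<Sum>j<N. cmod (c j))"
        using elim by (intro sum_norm_le) (simp add: norm_mult norm_power)
      also have "\<dots> \<le> (\<Sum>j. cmod (c j))"
        using c by (intro sum_le_suminf) auto
      finally show ?case by (intro ennreal_leI power_mono) auto
    qed
    show "AE w in circle_arclen. (\<lambda>N. ennreal ((cmod (?P N w))\<^sup>2)) \<longlonglongrightarrow> ennreal ((cmod (\<Sum>j. c j * w ^ j))\<^sup>2)"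
      using AE_circle_arclen
    proof eventually_elim
      case (elim w)
      have "summable (\<lambda>j. c j * w ^ j)"
        using c elim by (intro summable_norm_cancel[of "\<lambda>j. c j * w ^ j"]) (simp add: norm_mult norm_power)
      then have "(\<lambda>N. ?P N w) \<longlonglongrightarrow> (\<Sum>j. c j * w ^ j)"
        by (rule summable_LIMSEQ)
      then show ?case by (intro tendsto_ennrealI tendsto_power tendsto_norm)
    qed
    show "(\<integral>\<^sup>+w. ennreal ((\<Sum>j. cmod (c j))\<^sup>2) \<partial>circle_arclen) < \<infinity>"
      by (simp add: emeasure_circle_arclen_UNIV ennreal_mult_less_top)
  qed measurable
  moreover have "(\<lambda>N. \<Sum>j<N. ennreal ((cmod (c j))\<^sup>2)) \<longlonglongrightarrow> (\<Sum>j. ennreal ((cmod (c j))\<^sup>2))"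
    by (intro summable_LIMSEQ) auto
  ultimately show ?thesis
    unfolding partial by (rule LIMSEQ_unique)
qed

text \<open>The radius \<open>R\<close> is arbitrary because the mean over the unit circle itself is needed as well, for
  functions that extend past it.\<close>
lemma nn_integral_circle_taylor:
  assumes h: "h holomorphic_on ball 0 R" and z: "cmod z < R"
  shows "(\<integral>\<^sup>+w. ennreal ((cmod (h (z * w)))\<^sup>2) \<partial>circle_arclen)
    = (\<Sum>m. ennreal ((cmod ((deriv ^^ m) h 0 / fact m))\<^sup>2 * (cmod z)\<^sup>2 ^ m))"
proof -
  define c where "c = (\<lambda>m. (deriv ^^ m) h 0 / fact m)"
  have sums: "(\<lambda>m. c m * u ^ m) sums h u" if "cmod u < R" for u
    using holomorphic_power_series[OF h, of u] that by (simp add: c_def)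
  have abs: "summable (\<lambda>m. cmod (c m * z ^ m))"
  proof -
    obtain K where K: "cmod z < K" "K < R" using dense[OF z] by blast
    then have "summable (\<lambda>m. c m * of_real K ^ m)"
      using le_less_trans[OF norm_ge_zero K(1)]
      by (intro sums_summable[OF sums]) simp
    then show ?thesis
      using K le_less_trans[OF norm_ge_zero K(1)] by (intro powser_insidea[of c "of_real K"]) auto
  qed
  have "(\<integral>\<^sup>+w. ennreal ((cmod (h (z * w)))\<^sup>2) \<partial>circle_arclen)
     = (\<integral>\<^sup>+w. ennreal ((cmod (\<Sum>m. (c m * z ^ m) * w ^ m))\<^sup>2) \<partial>circle_arclen)"
  proof (rule nn_integral_cong_AE, use AE_circle_arclen in eventually_elim)
    case (elim w)
    then have "(\<Sum>m. c m * (z * w) ^ m) = h (z * w)"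
      using sums[of "z * w"] z by (simp add: norm_mult sums_iff)
    then show ?case by (simp add: power_mult_distrib mult_ac)
  qed
  also have "\<dots> = (\<Sum>m. ennreal ((cmod (c m * z ^ m))\<^sup>2))"
    by (rule nn_integral_circle_power_series[OF abs])
  also have "(\<lambda>m. (cmod (c m * z ^ m))\<^sup>2) = (\<lambda>m. (cmod (c m))\<^sup>2 * (cmod z)\<^sup>2 ^ m)"
    by (simp add: norm_mult norm_power power_mult_distrib mult.commute flip: power_mult)
  finally show ?thesis by (simp add: c_def)
qed

text \<open>By Parseval, the integral means are power series in \<open>r\<^sup>2\<close> with nonnegative coefficients, so they
  increase to the sum of the coefficients.\<close>
lemma hardy2_norm_sq_taylor:
  assumes h: "h holomorphic_on unit_disc"
  shows "hardy2_norm_sq h = (\<Sum>m. ennreal ((cmod ((deriv ^^ m) h 0 / fact m))\<^sup>2))"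
proof -
  define b where "b = (\<lambda>m. (cmod ((deriv ^^ m) h 0 / fact m))\<^sup>2)"
  have b: "b m \<ge> 0" for m by (simp add: b_def)
  have eq: "hardy2_norm_sq h = (SUP r\<in>{0..<1::real}. \<Sum>m. ennreal (b m * r\<^sup>2 ^ m))"
    unfolding hardy2_norm_sq_def b_def
    by (intro SUP_cong refl) (subst nn_integral_circle_taylor[OF h], auto)
  have "hardy2_norm_sq h = (\<Sum>m. ennreal (b m))"
    unfolding eq
  proof (rule antisym)
    show "(SUP r\<in>{0..<1::real}. \<Sum>m. ennreal (b m * r\<^sup>2 ^ m)) \<le> (\<Sum>m. ennreal (b m))"
      using b by (intro SUP_least suminf_le ennreal_leI mult_left_le power_le_one)
        (auto simp: power_le_one)
    show "(\<Sum>m. ennreal (b m)) \<le> (SUP r\<in>{0..<1::real}. \<Sum>m. ennreal (b m * r\<^sup>2 ^ m))" (is "_ \<le> ?S")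
    proof (rule suminf_le_const[OF summableI])
      fix N
      have "((\<lambda>r. \<Sum>m<N. b m * r\<^sup>2 ^ m) \<longlongrightarrow> (\<Sum>m<N. b m * 1\<^sup>2 ^ m)) (at_left (1::real))"
        by (intro tendsto_intros)
      then have "((\<lambda>r. ennreal (\<Sum>m<N. b m * r\<^sup>2 ^ m)) \<longlongrightarrow> ennreal (\<Sum>m<N. b m)) (at_left (1::real))"
        by (intro tendsto_ennrealI) simp
      moreover have "\<forall>\<^sub>F r in at_left (1::real). ennreal (\<Sum>m<N. b m * r\<^sup>2 ^ m) \<le> ?S"
      proof -
        have "\<forall>\<^sub>F r in at_left (1::real). r \<in> {0<..<1}"
          by (rule eventually_at_left_real) simp
        then show ?thesis
        proof eventually_elim
          case (elim r)
          have "ennreal (\<Sum>m<N. b m * r\<^sup>2 ^ m) = (\<Sum>m<N. ennreal (b m * r\<^sup>2 ^ m))"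
            using b by (intro sum_ennreal[symmetric]) auto
          also have "\<dots> \<le> (\<Sum>m. ennreal (b m * r\<^sup>2 ^ m))"
            by (intro sum_le_suminf) auto
          also have "\<dots> \<le> ?S"
            using elim by (intro SUP_upper) auto
          finally show ?case .
        qed
      qed
      ultimately have "ennreal (\<Sum>m<N. b m) \<le> ?S"
        by (intro tendsto_upperbound) auto
      then show "(\<Sum>m<N. ennreal (b m)) \<le> ?S"
        using b by (subst sum_ennreal) auto
    qed
  qed
  then show ?thesis by (simp add: b_def)
qed

lemma hardy2_norm_sq_cong:
  assumes "f holomorphic_on unit_disc" "g holomorphic_on unit_disc" "\<And>z. z \<in> unit_disc \<Longrightarrow> f z = g z"
  shows "hardy2_norm_sq f = hardy2_norm_sq g"
  using higher_deriv_transform_within_open[OF assms(1,2) open_ball _ assms(3), of 0]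
  by (simp add: hardy2_norm_sq_taylor assms)

lemma hardy2_norm_sq_cmult:
  assumes "f holomorphic_on unit_disc"
  shows "hardy2_norm_sq (\<lambda>z. k * f z) = ennreal ((cmod k)\<^sup>2) * hardy2_norm_sq f"
proof -
  have "(\<lambda>z. k * f z) holomorphic_on unit_disc"
    using assms by (intro holomorphic_intros)
  then show ?thesis
    using assms higher_deriv_cmult[OF assms, of 0 _ k]
    by (simp add: hardy2_norm_sq_taylor norm_mult norm_divide power_mult_distrib power_divide
         ennreal_mult flip: times_divide_eq_right)
qed

section \<open>The Hardy space under the involution\<close>

text \<open>A Malmquist sum is holomorphic past the unit circle, so its mean over the unit circle is the
  largest of its means over circles of radius at most \<open>1\<close>, and that mean is known by orthogonality.\<close>
lemma malmquist_sum_integral_mean_le: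
  assumes a: "cmod a < 1" and r: "0 \<le> r" "r < 1"
  shows "(\<integral>\<^sup>+w. ennreal ((cmod (\<Sum>j<N. c j * malmquist a j (of_real r * w)))\<^sup>2) \<partial>circle_arclen)
     \<le> ennreal ((\<Sum>j<N. (cmod (c j))\<^sup>2) / (1 - (cmod a)\<^sup>2))"
proof -
  \<comment> \<open>any radius strictly between \<open>1\<close> and \<open>1 / |a|\<close> would do; this one also makes sense for \<open>a = 0\<close>\<close>
  define R where "R = 2 / (1 + cmod a)"
  have R: "R > 1" using a by (simp add: R_def divide_simps add_pos_nonneg)
  have aR: "cmod a * R < 1" using a by (simp add: R_def divide_simps add_pos_nonneg)
  define h where "h = (\<lambda>z. \<Sum>j<N. c j * malmquist a j z)"
  have nz: "1 - cnj a * z \<noteq> 0" if "z \<in> ball 0 R" for z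
  proof
    assume "1 - cnj a * z = 0"
    then have "cmod (cnj a * z) = 1" by (metis eq_iff_diff_eq_0 norm_one)
    moreover have "cmod a * cmod z \<le> cmod a * R" using that by (intro mult_left_mono) auto
    ultimately show False using aR by (simp add: norm_mult)
  qed
  have h: "h holomorphic_on ball 0 R"
    unfolding h_def malmquist_def disc_involution_def using nz by (intro holomorphic_intros) auto
  have "(\<integral>\<^sup>+w. ennreal ((cmod (h (of_real r * w)))\<^sup>2) \<partial>circle_arclen)
     = (\<Sum>m. ennreal ((cmod ((deriv ^^ m) h 0 / fact m))\<^sup>2 * (cmod (of_real r))\<^sup>2 ^ m))"
    using r R by (intro nn_integral_circle_taylor[OF h]) auto
  also have "\<dots> \<le> (\<Sum>m. ennreal ((cmod ((deriv ^^ m) h 0 / fact m))\<^sup>2 * (cmod 1)\<^sup>2 ^ m))"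
    using r by (intro suminf_le ennreal_leI mult_left_mono power_mono) auto
  also have "\<dots> = (\<integral>\<^sup>+w. ennreal ((cmod (h (1 * w)))\<^sup>2) \<partial>circle_arclen)"
    using R by (intro nn_integral_circle_taylor[OF h, symmetric]) auto
  also have "\<dots> = ennreal ((\<Sum>j<N. (cmod (c j))\<^sup>2) / (1 - (cmod a)\<^sup>2))"
    unfolding h_def mult_1_left by (rule nn_integral_circle_malmquist_sum[OF a])
  finally show ?thesis by (simp add: h_def)
qed

lemma holomorphic_compose_involution:
  assumes a: "cmod a < 1" and f: "f holomorphic_on unit_disc"
  shows "(\<lambda>z. f (disc_involution a z)) holomorphic_on unit_disc"
proof -
  have "disc_involution a holomorphic_on unit_disc"
    using holomorphic_on_disc_involution[OF a] by (rule holomorphic_on_subset) auto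
  then have "f \<circ> disc_involution a holomorphic_on unit_disc"
    using f by (rule holomorphic_on_compose_gen) (simp add: image_disc_involution[OF a])
  then show ?thesis by (simp add: o_def)
qed

text \<open>For Taylor polynomials of \<open>f\<close> the bound comes from orthogonality of the Malmquist functions;
  Fatou's lemma on each circle of radius \<open>r < 1\<close> extends it to \<open>f\<close>.\<close>
lemma hardy2_norm_sq_involution_le:
  assumes a: "cmod a < 1" and f: "f holomorphic_on unit_disc"
  shows "hardy2_norm_sq (\<lambda>z. f (disc_involution a z) / (1 - cnj a * z))
    \<le> ennreal (1 / (1 - (cmod a)\<^sup>2)) * hardy2_norm_sq f"
  unfolding hardy2_norm_sq_def[of "\<lambda>z. f (disc_involution a z) / (1 - cnj a * z)"]
proof (rule SUP_least)
  fix r :: real assume "r \<in> {0..<1}"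
  then have r: "0 \<le> r" "r < 1" by auto
  define c where "c = (\<lambda>m. (deriv ^^ m) f 0 / fact m)"
  let ?h = "\<lambda>z. f (disc_involution a z) / (1 - cnj a * z)"
  let ?S = "\<lambda>N w. \<Sum>j<N. c j * malmquist a j (of_real r * w)"
  have [measurable]: "(\<lambda>w. malmquist a j (of_real r * w)) \<in> borel_measurable borel" for j
    unfolding malmquist_def disc_involution_def by measurable
  have "(\<integral>\<^sup>+w. ennreal ((cmod (?h (of_real r * w)))\<^sup>2) \<partial>circle_arclen)
     = (\<integral>\<^sup>+w. liminf (\<lambda>N. ennreal ((cmod (?S N w))\<^sup>2)) \<partial>circle_arclen)"
  proof (rule nn_integral_cong_AE, use AE_circle_arclen in eventually_elim)
    case (elim w)
    define z where "z = of_real r * w"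
    have "cmod z < 1" using elim r by (simp add: z_def norm_mult)
    then have "disc_involution a z \<in> unit_disc" using disc_involution_in_disc[OF a] by simp
    from holomorphic_power_series[OF f this]
    have "(\<lambda>j. c j * disc_involution a z ^ j / (1 - cnj a * z)) sums ?h z"
      unfolding c_def by (intro sums_divide) simp
    then have "(\<lambda>N. ?S N w) \<longlonglongrightarrow> ?h z"
      unfolding z_def[symmetric] malmquist_def by (simp add: sums_def)
    then have "(\<lambda>N. ennreal ((cmod (?S N w))\<^sup>2)) \<longlonglongrightarrow> ennreal ((cmod (?h z))\<^sup>2)"
      by (intro tendsto_ennrealI tendsto_power tendsto_norm)
    then show ?case
      unfolding z_def by (intro lim_imp_Liminf[symmetric]) simp_all
  qed
  also have "\<dots> \<le> liminf (\<lambda>N. \<integral>\<^sup>+w. ennreal ((cmod (?S N w))\<^sup>2) \<partial>circle_arclen)"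
    by (rule nn_integral_liminf) measurable
  also have "\<dots> \<le> limsup (\<lambda>N. \<integral>\<^sup>+w. ennreal ((cmod (?S N w))\<^sup>2) \<partial>circle_arclen)"
    by (rule Liminf_le_Limsup) simp
  also have "\<dots> \<le> ennreal (1 / (1 - (cmod a)\<^sup>2)) * hardy2_norm_sq f"
  proof (rule Limsup_bounded, rule always_eventually, rule allI)
    fix N
    have "(\<integral>\<^sup>+w. ennreal ((cmod (?S N w))\<^sup>2) \<partial>circle_arclen)
        \<le> ennreal ((\<Sum>j<N. (cmod (c j))\<^sup>2) / (1 - (cmod a)\<^sup>2))"
      by (rule malmquist_sum_integral_mean_le[OF a r])
    also have "\<dots> = ennreal (1 / (1 - (cmod a)\<^sup>2)) * (\<Sum>j<N. ennreal ((cmod (c j))\<^sup>2))"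
      using a by (simp add: sum_nonneg abs_square_le_1 flip: ennreal_mult)
    also have "\<dots> \<le> ennreal (1 / (1 - (cmod a)\<^sup>2)) * hardy2_norm_sq f"
      unfolding hardy2_norm_sq_taylor[OF f] c_def
      by (intro mult_left_mono sum_le_suminf) auto
    finally show "(\<integral>\<^sup>+w. ennreal ((cmod (?S N w))\<^sup>2) \<partial>circle_arclen)
        \<le> ennreal (1 / (1 - (cmod a)\<^sup>2)) * hardy2_norm_sq f" .
  qed
  finally show "(\<integral>\<^sup>+w. ennreal ((cmod (?h (of_real r * w)))\<^sup>2) \<partial>circle_arclen)
     \<le> ennreal (1 / (1 - (cmod a)\<^sup>2)) * hardy2_norm_sq f" .
qed

text \<open>The operator \<open>f \<mapsto> (f o \<phi>) / (1 - cnj a z)\<close> is its own inverse up to a constant, so that the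
  one-sided bound, applied to \<open>f\<close> and to its image, is an equality.\<close>
lemma hardy2_norm_sq_involution:
  assumes a: "cmod a < 1" and f: "f holomorphic_on unit_disc"
  shows "hardy2_norm_sq f
    = ennreal (1 - (cmod a)\<^sup>2) * hardy2_norm_sq (\<lambda>z. f (disc_involution a z) / (1 - cnj a * z))"
proof (rule antisym)
  define c where "c = 1 - (cmod a)\<^sup>2"
  have c: "c > 0" using a by (simp add: c_def abs_square_less_1)
  let ?T = "\<lambda>f z. f (disc_involution a z) / (1 - cnj a * z)"
  have hol: "?T g holomorphic_on unit_disc" if "g holomorphic_on unit_disc" for g
    using involution_denominator_nonzero[OF a]
    by (intro holomorphic_intros holomorphic_compose_involution a that) auto
  have "?T (?T f) z = of_real (1 / c) * f z" if "z \<in> unit_disc" for z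
    using that a involution_denominator_compose[of a z]
    by (simp add: disc_involution_involutive c_def divide_divide_eq_left')
  then have "hardy2_norm_sq (?T (?T f)) = hardy2_norm_sq (\<lambda>z. of_real (1 / c) * f z)"
    by (intro hardy2_norm_sq_cong hol f holomorphic_intros)
  also have "\<dots> = ennreal ((1 / c)\<^sup>2) * hardy2_norm_sq f"
    using hardy2_norm_sq_cmult[OF f, of "of_real (1 / c)"] c by (simp add: norm_divide)
  finally have "ennreal ((1 / c)\<^sup>2) * hardy2_norm_sq f \<le> ennreal (1 / c) * hardy2_norm_sq (?T f)"
    using hardy2_norm_sq_involution_le[OF a hol[OF f]] by (simp add: c_def)
  then have "ennreal (c\<^sup>2) * (ennreal ((1 / c)\<^sup>2) * hardy2_norm_sq f)
     \<le> ennreal (c\<^sup>2) * (ennreal (1 / c) * hardy2_norm_sq (?T f))"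
    by (rule mult_left_mono) simp
  then show "hardy2_norm_sq f \<le> ennreal (1 - (cmod a)\<^sup>2) * hardy2_norm_sq (?T f)"
    using c unfolding mult.assoc[symmetric] c_def[symmetric]
    by (simp add: power2_eq_square flip: ennreal_mult)
  have "ennreal c * hardy2_norm_sq (?T f) \<le> ennreal c * (ennreal (1 / c) * hardy2_norm_sq f)"
    using hardy2_norm_sq_involution_le[OF a f] unfolding c_def by (intro mult_left_mono) simp_all
  also have "\<dots> = hardy2_norm_sq f"
    using c unfolding mult.assoc[symmetric] by (simp flip: ennreal_mult)
  finally show "ennreal (1 - (cmod a)\<^sup>2) * hardy2_norm_sq (?T f) \<le> hardy2_norm_sq f"
    by (simp add: c_def)
qed

section \<open>Radial weights\<close>

lemma finite_measure_disc_area: "finite_measure disc_area"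
proof (rule finite_measureI)
  have "emeasure disc_area unit_disc = ennreal (1 / pi) * emeasure lborel unit_disc"
    by (rule emeasure_disc_area) auto
  then show "emeasure disc_area (space disc_area) \<noteq> \<infinity>"
    by (simp add: emeasure_ball ennreal_mult_eq_top_iff)
qed

lemma finite_measure_circle_arclen: "finite_measure circle_arclen"
  by (rule finite_measureI) (simp add: emeasure_circle_arclen_UNIV)

lemma borel_measurable_disc_area:
  assumes "f \<in> borel_measurable borel"
  shows "f \<in> borel_measurable disc_area"
proof -
  have "f \<in> borel_measurable (restrict_space borel unit_disc)"
    using assms by (rule measurable_restrict_space1)
  then show ?thesis
    unfolding measurable_cong_sets[OF sets_disc_area refl] .
qed

text \<open>The disc of radius \<open>sqrt x\<close> has normalized area \<open>x\<close>, so \<open>|z|\<^sup>2\<close> is uniformly distributed on \<open>[0,1]\<close>.\<close>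
lemma distr_disc_area_cmod_sq:
  "distr disc_area borel (\<lambda>z. (cmod z)\<^sup>2) = density lborel (indicator {0..1::real})"
proof (rule measure_eqI_lessThan)
  have meas: "(\<lambda>z. (cmod z)\<^sup>2) \<in> borel_measurable disc_area"
    by (intro borel_measurable_disc_area) measurable
  fix x :: real
  have vol: "emeasure lborel (ball (0::complex) r) = ennreal (pi * r\<^sup>2)"
            "emeasure lborel (cball (0::complex) r) = ennreal (pi * r\<^sup>2)" if "r \<ge> 0" for r
    using that by (simp_all add: emeasure_ball emeasure_cball unit_ball_vol_2)
  have "emeasure (distr disc_area borel (\<lambda>z. (cmod z)\<^sup>2)) {x<..}
      = emeasure disc_area ((\<lambda>z. (cmod z)\<^sup>2) -` {x<..} \<inter> unit_disc)"
    using meas by (subst emeasure_distr) auto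
  also have "(\<lambda>z. (cmod z)\<^sup>2) -` {x<..} \<inter> unit_disc = unit_disc - {z. (cmod z)\<^sup>2 \<le> x}"
    by auto
  also have "emeasure disc_area (unit_disc - {z. (cmod z)\<^sup>2 \<le> x}) = ennreal (1 / pi) * emeasure lborel (unit_disc - {z. (cmod z)\<^sup>2 \<le> x})"
    by (rule emeasure_disc_area) auto
  also have "\<dots> = ennreal (1 - min 1 (max 0 x))"
  proof -
    consider "x < 0" | "0 \<le> x" "x < 1" | "x \<ge> 1" by linarith
    then show ?thesis
    proof cases
      case 1
      then have "{z::complex. (cmod z)\<^sup>2 \<le> x} = {}" 
        by (auto simp: not_le intro: less_le_trans[OF _ zero_le_power2])
      then show ?thesis using 1 vol[of 1] by (simp flip: ennreal_mult)
    next
      case 2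
      have "{z::complex. (cmod z)\<^sup>2 \<le> x} = cball 0 (sqrt x)"
        using 2 by (auto simp: real_le_rsqrt sqrt_ge_absD)
      moreover have "cball 0 (sqrt x) \<subseteq> (unit_disc :: complex set)"
        using 2 le_less_trans[of _ "sqrt x" 1] by auto
      then have "emeasure lborel (unit_disc - cball (0::complex) (sqrt x)) = ennreal (pi * (1 - x))"
        using 2 vol[of 1] vol[of "sqrt x"]
        by (subst emeasure_Diff) (auto simp: ennreal_minus right_diff_distrib)
      moreover have "ennreal (1 / pi) * ennreal (pi * (1 - x)) = ennreal (1 - x)"
        using 2 by (subst ennreal_mult[symmetric]) auto
      ultimately show ?thesis
        using 2 by simp
    next
      case 3
      have "(cmod z)\<^sup>2 \<le> x" if "z \<in> unit_disc" for z :: complex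
        using that 3 abs_square_less_1[of "cmod z"] by simp
      then have "unit_disc - {z::complex. (cmod z)\<^sup>2 \<le> x} = {}"
        by blast
      then show ?thesis using 3 by (simp only: emeasure_empty) simp
    qed
  qed
  finally have 1: "emeasure (distr disc_area borel (\<lambda>z. (cmod z)\<^sup>2)) {x<..} = ennreal (1 - min 1 (max 0 x))" .
  have "emeasure (density lborel (indicator {0..1::real})) {x<..} = emeasure lborel ({0..1} \<inter> {x<..})"
  proof -
    have "(\<lambda>t. indicator {0..1} t * indicator {x<..} t :: ennreal) = indicator ({0..1} \<inter> {x<..})"
      by (auto simp: fun_eq_iff split: split_indicator)
    then show ?thesis by (simp add: emeasure_density)
  qed
  also have "\<dots> = ennreal (1 - min 1 (max 0 x))"
  proof (cases "x < 0")
    case True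
    then have "{0..1} \<inter> {x<..} = {0..1}" by auto
    then show ?thesis using True by simp
  next
    case False
    then have "{0..1} \<inter> {x<..} = {x<..1}" by auto
    then show ?thesis using False by (cases "x \<le> 1") auto
  qed
  finally show "emeasure (distr disc_area borel (\<lambda>z. (cmod z)\<^sup>2)) {x<..}
     = emeasure (density lborel (indicator {0..1::real})) {x<..}"
    using 1 by simp
  show "emeasure (distr disc_area borel (\<lambda>z. (cmod z)\<^sup>2)) {x<..} < \<infinity>"
    using 1 by simp
qed simp_all

lemma nn_integral_disc_area_radial:
  assumes w: "w \<in> borel_measurable borel"
  shows "(\<integral>\<^sup>+z. w ((cmod z)\<^sup>2) \<partial>disc_area) = (\<integral>\<^sup>+t. w t * indicator {0..1} t \<partial>lborel)"
proof -
  have "(\<lambda>z. (cmod z)\<^sup>2) \<in> borel_measurable disc_area"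
    by (intro borel_measurable_disc_area) measurable
  then have "(\<integral>\<^sup>+z. w ((cmod z)\<^sup>2) \<partial>disc_area) = (\<integral>\<^sup>+t. w t \<partial>distr disc_area borel (\<lambda>z. (cmod z)\<^sup>2))"
    using w by (subst nn_integral_distr) auto
  also have "\<dots> = (\<integral>\<^sup>+t. w t * indicator {0..1} t \<partial>lborel)"
    unfolding distr_disc_area_cmod_sq using w by (subst nn_integral_density) (auto simp: mult.commute)
  finally show ?thesis .
qed

lemma nn_integral_disc_area_rotate:
  assumes F: "F \<in> borel_measurable disc_area" and \<eta>: "cmod \<eta> = 1"
  shows "(\<integral>\<^sup>+z. F (\<eta> * z) \<partial>disc_area) = (\<integral>\<^sup>+z. F z \<partial>disc_area)"
proof -
  have "\<eta> \<noteq> 0" using \<eta> by auto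
  have "(\<lambda>z. \<eta> * z) ` unit_disc = unit_disc"
  proof
    show "unit_disc \<subseteq> (\<lambda>z. \<eta> * z) ` unit_disc"
    proof
      fix z :: complex assume "z \<in> unit_disc"
      then have "z = \<eta> * (z / \<eta>)" "z / \<eta> \<in> unit_disc" using \<eta> \<open>\<eta> \<noteq> 0\<close> by (auto simp: norm_divide)
      then show "z \<in> (\<lambda>z. \<eta> * z) ` unit_disc" by (rule image_eqI)
    qed
  qed (auto simp: norm_mult \<eta>)
  then have "(\<integral>\<^sup>+z. F z \<partial>disc_area) = (\<integral>\<^sup>+z. ennreal ((cmod (deriv (\<lambda>z. \<eta> * z) z))\<^sup>2) * F (\<eta> * z) \<partial>disc_area)"
    using \<open>\<eta> \<noteq> 0\<close> by (intro nn_integral_disc_area_substitution F holomorphic_intros) (auto simp: inj_on_def)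
  then show ?thesis by (simp add: \<eta>)
qed

text \<open>A radial weight does not see rotations: replacing \<open>h(z)\<close> by \<open>h(\<eta> z)\<close> and averaging over \<open>|\<eta>| = 1\<close> leaves
  the integral unchanged, while Parseval evaluates the average of \<open>|h(\<eta> z)|\<^sup>2\<close> as a power series in \<open>|z|\<^sup>2\<close>.\<close>
lemma nn_integral_disc_area_taylor:
  assumes h: "h holomorphic_on unit_disc" and w: "w \<in> borel_measurable borel"
  shows "(\<integral>\<^sup>+z. ennreal ((cmod (h z))\<^sup>2) * w ((cmod z)\<^sup>2) \<partial>disc_area)
    = (\<Sum>m. ennreal ((cmod ((deriv ^^ m) h 0 / fact m))\<^sup>2) * (\<integral>\<^sup>+t. ennreal (t ^ m) * w t * indicator {0..1} t \<partial>lborel))"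
proof -
  note w[measurable]
  \<comment> \<open>cutting off outside the disc makes the integrand Borel on the whole plane, hence \<open>F(\<eta> z)\<close> jointly measurable\<close>
  define F where "F = (\<lambda>z. ennreal ((cmod (h z))\<^sup>2) * indicator unit_disc z * w ((cmod z)\<^sup>2))"
  define b where "b = (\<lambda>m. (cmod ((deriv ^^ m) h 0 / fact m))\<^sup>2)"
  have "(\<lambda>z. ennreal ((cmod (h z))\<^sup>2)) \<in> borel_measurable (restrict_space borel unit_disc)"
    using h by (intro measurable_compose[OF _ measurable_ennreal] borel_measurable_continuous_on_restrict
      continuous_intros holomorphic_on_imp_continuous_on)
  then have "(\<lambda>z. ennreal ((cmod (h z))\<^sup>2) * indicator unit_disc z) \<in> borel_measurable borel"
    by (subst (asm) borel_measurable_restrict_space_iff_ennreal) auto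
  then have F[measurable]: "F \<in> borel_measurable borel"
    unfolding F_def using w by measurable
  interpret C: finite_measure circle_arclen by (rule finite_measure_circle_arclen)
  interpret D: finite_measure disc_area by (rule finite_measure_disc_area)
  interpret CD: pair_sigma_finite circle_arclen disc_area ..
  have "(\<integral>\<^sup>+z. ennreal ((cmod (h z))\<^sup>2) * w ((cmod z)\<^sup>2) \<partial>disc_area) = (\<integral>\<^sup>+z. F z \<partial>disc_area)"
    by (intro nn_integral_cong) (simp add: F_def)
  also have "\<dots> = (\<integral>\<^sup>+\<eta>. (\<integral>\<^sup>+z. F z \<partial>disc_area) \<partial>circle_arclen)"
    by (simp add: emeasure_circle_arclen_UNIV)
  also have "\<dots> = (\<integral>\<^sup>+\<eta>. (\<integral>\<^sup>+z. F (\<eta> * z) \<partial>disc_area) \<partial>circle_arclen)"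
    using nn_integral_disc_area_rotate[OF borel_measurable_disc_area[OF F]]
    by (intro nn_integral_cong_AE) (use AE_circle_arclen in eventually_elim, simp)
  also have "\<dots> = (\<integral>\<^sup>+z. (\<integral>\<^sup>+\<eta>. F (\<eta> * z) \<partial>circle_arclen) \<partial>disc_area)"
  proof (rule CD.Fubini'[symmetric])
    have "(\<lambda>z::complex. z) \<in> borel_measurable disc_area"
      by (rule borel_measurable_disc_area) simp
    then have "(\<lambda>p. fst p * snd p) \<in> borel_measurable (circle_arclen \<Otimes>\<^sub>M disc_area)"
      by (intro borel_measurable_times measurable_compose[OF measurable_fst] measurable_compose[OF measurable_snd])
         (auto simp: sets_circle_arclen cong: measurable_cong_sets)
    from measurable_compose[OF this F]
    show "(\<lambda>(\<eta>, z). F (\<eta> * z)) \<in> borel_measurable (circle_arclen \<Otimes>\<^sub>M disc_area)"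
      by (simp add: case_prod_beta')
  qed
  also have "\<dots> = (\<integral>\<^sup>+z. (\<Sum>m. ennreal (b m) * (ennreal ((cmod z)\<^sup>2 ^ m) * w ((cmod z)\<^sup>2))) \<partial>disc_area)"
  proof (rule nn_integral_cong)
    fix z assume "z \<in> space disc_area"
    then have z: "cmod z < 1" by simp
    have meas: "(\<lambda>\<eta>. ennreal ((cmod (h (z * \<eta>)))\<^sup>2) * indicator unit_disc (z * \<eta>)) \<in> borel_measurable circle_arclen"
    proof -
      have "(\<lambda>\<eta>. z * \<eta>) \<in> borel_measurable circle_arclen" by measurable
      from measurable_compose[OF this \<open>(\<lambda>z. ennreal ((cmod (h z))\<^sup>2) * indicator unit_disc z) \<in> borel_measurable borel\<close>]
      show ?thesis .
    qed
    have in_disc: "AE \<eta> in circle_arclen. z * \<eta> \<in> unit_disc"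
      using AE_circle_arclen by eventually_elim (use z in \<open>simp add: norm_mult\<close>)
    have "(\<integral>\<^sup>+\<eta>. F (\<eta> * z) \<partial>circle_arclen)
       = (\<integral>\<^sup>+\<eta>. ennreal ((cmod (h (z * \<eta>)))\<^sup>2) * indicator unit_disc (z * \<eta>) * w ((cmod z)\<^sup>2) \<partial>circle_arclen)"
      by (rule nn_integral_cong_AE, use AE_circle_arclen in eventually_elim)
         (simp add: F_def norm_mult mult.commute)
    also have "\<dots> = (\<integral>\<^sup>+\<eta>. ennreal ((cmod (h (z * \<eta>)))\<^sup>2) * indicator unit_disc (z * \<eta>) \<partial>circle_arclen) * w ((cmod z)\<^sup>2)"
      by (rule nn_integral_multc[OF meas])
    also have "(\<integral>\<^sup>+\<eta>. ennreal ((cmod (h (z * \<eta>)))\<^sup>2) * indicator unit_disc (z * \<eta>) \<partial>circle_arclen)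
       = (\<integral>\<^sup>+\<eta>. ennreal ((cmod (h (z * \<eta>)))\<^sup>2) \<partial>circle_arclen)"
      by (rule nn_integral_cong_AE, use in_disc in eventually_elim) simp
    also have "\<dots> = (\<Sum>m. ennreal (b m * (cmod z)\<^sup>2 ^ m))"
      unfolding b_def by (rule nn_integral_circle_taylor[OF h z])
    also have "\<dots> * w ((cmod z)\<^sup>2) = (\<Sum>m. ennreal (b m * (cmod z)\<^sup>2 ^ m) * w ((cmod z)\<^sup>2))"
      by (rule ennreal_suminf_multc[symmetric])
    also have "\<dots> = (\<Sum>m. ennreal (b m) * (ennreal ((cmod z)\<^sup>2 ^ m) * w ((cmod z)\<^sup>2)))"
      by (simp add: b_def ennreal_mult mult.assoc)
    finally show "(\<integral>\<^sup>+\<eta>. F (\<eta> * z) \<partial>circle_arclen)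
      = (\<Sum>m. ennreal (b m) * (ennreal ((cmod z)\<^sup>2 ^ m) * w ((cmod z)\<^sup>2)))" .
  qed
  also have "\<dots> = (\<Sum>m. \<integral>\<^sup>+z. ennreal (b m) * (ennreal ((cmod z)\<^sup>2 ^ m) * w ((cmod z)\<^sup>2)) \<partial>disc_area)"
    by (intro nn_integral_suminf borel_measurable_disc_area) measurable
  also have "\<dots> = (\<Sum>m. ennreal (b m) * (\<integral>\<^sup>+z. ennreal ((cmod z)\<^sup>2 ^ m) * w ((cmod z)\<^sup>2) \<partial>disc_area))"
    by (intro arg_cong[of _ _ suminf] ext nn_integral_cmult borel_measurable_disc_area) measurable
  also have "\<dots> = (\<Sum>m. ennreal (b m) * (\<integral>\<^sup>+t. ennreal (t ^ m) * w t * indicator {0..1} t \<partial>lborel))"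
    by (intro arg_cong[of _ _ suminf] ext arg_cong2[of _ _ _ _ "(*)"] refl nn_integral_disc_area_radial) measurable
  finally show ?thesis by (simp add: b_def)
qed

section \<open>Moments of the weights\<close>

lemma has_integral_power_one_minus_power:
  "((\<lambda>t::real. t ^ m * (1 - t) ^ n) has_integral fact m * fact n / fact (m + n + 1)) {0..1}"
proof -
  have "((\<lambda>t. t powr (real (m + 1) - 1) * (1 - t) powr (real (n + 1) - 1)) has_integral
      Beta (real (m + 1)) (real (n + 1))) {0..1}"
    by (rule has_integral_Beta_real) auto
  moreover have "Beta (real (m + 1)) (real (n + 1)) = fact m * fact n / fact (m + n + 1)"
    using Gamma_fact[of m, where ?'a = real] Gamma_fact[of n, where ?'a = real] Gamma_fact[of "m + n + 1", where ?'a = real]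
    by (simp add: Beta_def add_ac)
  ultimately have "((\<lambda>t. t powr (real (m + 1) - 1) * (1 - t) powr (real (n + 1) - 1)) has_integral
      fact m * fact n / fact (m + n + 1)) {0..1}"
    by simp
  \<comment> \<open>at the end points \<open>0 powr 0 = 0\<close> differs from \<open>0 ^ 0 = 1\<close>\<close>
  then show ?thesis
    by (rule has_integral_spike_finite[of "{0, 1}", rotated 2]) (auto simp: powr_realpow)
qed

text \<open>At \<open>0\<close> the default value \<open>ln 0 = 0\<close> is harmless, as \<open>t ln t\<close> tends to \<open>0\<close>.\<close>
lemma continuous_on_mult_ln: "continuous_on {0..1} (\<lambda>t::real. t * ln t)"
  unfolding continuous_on_eq_continuous_within
proof
  fix t :: real assume t: "t \<in> {0..1}"
  show "continuous (at t within {0..1}) (\<lambda>t. t * ln t)"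
  proof (cases "t = 0")
    case True
    have "((\<lambda>t::real. - (ln (inverse t) / inverse t)) \<longlongrightarrow> - 0) (at_right 0)"
      by (intro tendsto_minus filterlim_compose[OF ln_x_over_x_tendsto_0 filterlim_inverse_at_top_right])
    then have "((\<lambda>t::real. t * ln t) \<longlongrightarrow> 0) (at_right 0)"
      by (simp add: ln_inverse divide_inverse mult.commute)
    then show ?thesis
      by (simp add: True continuous_within at_within_Icc_at_right)
  next
    case False
    then have "((\<lambda>t. t * ln t) has_real_derivative ln t + 1) (at t)"
      using t by (auto intro!: derivative_eq_intros)
    then show ?thesis
      by (rule continuous_at_imp_continuous_at_within[OF DERIV_isCont])
  qed
qed

lemma has_integral_power_ln:
  "((\<lambda>t::real. t ^ m * (- ln t)) has_integral 1 / (real m + 1)\<^sup>2) {0..1}"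
proof -
  define c where "c = 1 / (real m + 1)"
  have mc: "real m * c = 1 - c" by (simp add: c_def field_simps)
  \<comment> \<open>the antiderivative found by parts, grouped so that it is visibly continuous at \<open>0\<close>\<close>
  define G where "G = (\<lambda>t::real. t ^ m * (c\<^sup>2 * t - c * (t * ln t)))"
  have "((\<lambda>t. t ^ m * (- ln t)) has_integral G 1 - G 0) {0..1}"
  proof (rule fundamental_theorem_of_calculus_interior)
    show "continuous_on {0..1} G"
      unfolding G_def by (intro continuous_intros continuous_on_mult_ln)
    fix t :: real assume t: "t \<in> {0<..<1}"
    have "(G has_real_derivative
        real m * t ^ (m - 1) * (c\<^sup>2 * t - c * (t * ln t)) + t ^ m * (c\<^sup>2 - c * (ln t + 1))) (at t)"
      unfolding G_def using t by (auto intro!: derivative_eq_intros simp: algebra_simps)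
    also have "real m * t ^ (m - 1) * (c\<^sup>2 * t - c * (t * ln t)) = t ^ m * ((real m * c) * (c - ln t))"
      by (cases m) (auto simp: algebra_simps power2_eq_square)
    also have "\<dots> + t ^ m * (c\<^sup>2 - c * (ln t + 1)) = t ^ m * (- ln t)"
      unfolding mc by (simp add: algebra_simps power2_eq_square)
    finally show "(G has_vector_derivative t ^ m * (- ln t)) (at t)"
      by (simp add: has_real_derivative_iff_has_vector_derivative)
  qed simp
  moreover have "G 1 - G 0 = 1 / (real m + 1)\<^sup>2" by (simp add: G_def c_def power_divide)
  ultimately show ?thesis by simp
qed

text \<open>The weight at the origin as a function of \<open>t = |z|\<^sup>2\<close>, up to a constant factor. For \<open>t > 0\<close> it is \<open>(-t)^n\<close>
  times the remainder of order \<open>n\<close> in the Taylor expansion of \<open>ln (1 + s)\<close> at \<open>s = (1 - t) / t\<close>.\<close>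
definition log_remainder :: "nat \<Rightarrow> real \<Rightarrow> real" where
  "log_remainder n t = (-1) ^ n * (t ^ n * (- ln t) + (\<Sum>l = 1..n. (-1) ^ l / real l * t ^ (n - l) * (1 - t) ^ l))"

text \<open>All terms of order \<open>n + 1\<close> except the last are \<open>t\<close> times the terms of order \<open>n\<close>, with the sign reversed.\<close>
lemma log_remainder_Suc:
  "log_remainder (Suc n) t = (1 - t) ^ Suc n / real (Suc n) - t * log_remainder n t"
proof -
  let ?S = "\<Sum>l = 1..n. (-1) ^ l / real l * t ^ (n - l) * (1 - t) ^ l"
  let ?s = "(-1) ^ n :: real"
  have "(\<Sum>l = 1..n. (-1) ^ l / real l * t ^ (Suc n - l) * (1 - t) ^ l) = t * ?S"
    unfolding sum_distrib_left by (rule sum.cong) (auto simp: Suc_diff_le)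
  then have "log_remainder (Suc n) t
     = - ?s * (t * t ^ n * (- ln t) + (t * ?S - ?s / real (Suc n) * (1 - t) ^ Suc n))"
    unfolding log_remainder_def by (simp del: of_nat_Suc)
  also have "\<dots> = (?s * ?s) * ((1 - t) ^ Suc n / real (Suc n)) - t * (?s * (t ^ n * (- ln t) + ?S))"
    by (simp only: algebra_simps) (simp del: of_nat_Suc)
  also have "?s * ?s = 1"
    by (simp only: power_mult_distrib[symmetric]) simp
  finally show ?thesis by (simp only: log_remainder_def mult_1_left)
qed

lemma U_weight_0: "U_weight 0 (Suc n) z = log_remainder n ((cmod z)\<^sup>2) / (fact n)\<^sup>2"
proof -
  have "ln ((cmod ((1 - z * cnj 0) / (0 - z)))\<^sup>2) = - ln ((cmod z)\<^sup>2)"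
    by (simp add: norm_divide power_divide ln_div)
  then show ?thesis
    by (simp add: U_weight_def G_kernel_def log_remainder_def power_mult)
qed

lemma log_remainder_nonneg:
  assumes "0 \<le> t" "t \<le> 1"
  shows "log_remainder n t \<ge> 0"
proof (cases "t = 1")
  case False
  then have "U_weight 0 (Suc n) (of_real (sqrt t)) \<ge> 0"
    using assms by (intro U_weight_nonneg) auto
  then show ?thesis
    using assms by (simp add: U_weight_0 zero_le_divide_iff)
qed (simp add: log_remainder_def)

text \<open>By the recursion, the \<open>m\<close>-th moment of order \<open>n + 1\<close> is a beta value minus the \<open>(m + 1)\<close>-st moment of
  order \<open>n\<close>; the induction starts from the integral of \<open>t^m ln t\<close>.\<close>
lemma has_integral_power_log_remainder:
  "((\<lambda>t. t ^ m * log_remainder n t) has_integral fact n * fact m / (fact (m + n + 1) * real (m + n + 1))) {0..1}"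
proof (induction n arbitrary: m)
  case 0
  then show ?case
    using has_integral_power_ln[of m] by (simp add: log_remainder_def power2_eq_square add_ac)
next
  case (Suc n)
  have "((\<lambda>t. t ^ m * (1 - t) ^ Suc n / real (Suc n) - t ^ Suc m * log_remainder n t) has_integral
    fact m * fact (Suc n) / fact (m + Suc n + 1) / real (Suc n)
     - fact n * fact (Suc m) / (fact (Suc m + n + 1) * real (Suc m + n + 1))) {0..1}"
    by (intro has_integral_diff has_integral_divide has_integral_power_one_minus_power Suc.IH)
  moreover have "(\<lambda>t. t ^ m * (1 - t) ^ Suc n / real (Suc n) - t ^ Suc m * log_remainder n t)
     = (\<lambda>t. t ^ m * log_remainder (Suc n) t)"
    by (simp add: log_remainder_Suc algebra_simps)
  moreover have "fact m * fact (Suc n) / fact (m + Suc n + 1) / real (Suc n)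
     - fact n * fact (Suc m) / (fact (Suc m + n + 1) * real (Suc m + n + 1))
    = fact (Suc n) * fact m / (fact (m + Suc n + 1) * real (m + Suc n + 1))"
  proof -
    have "m + Suc n + 1 = Suc m + n + 1" by simp
    moreover have "fact m * fact (Suc n) / X / real (Suc n) - fact n * fact (Suc m) / (X * real (Suc m + n + 1))
       = fact (Suc n) * fact m / (X * real (Suc m + n + 1))" if "X > 0" for X :: real
      using that by (simp add: divide_simps del: of_nat_Suc of_nat_add) (simp add: algebra_simps)
    ultimately show ?thesis by (metis fact_gt_zero)
  qed
  ultimately show ?case by simp
qed

section \<open>Higher derivatives under the involution\<close>

text \<open>Leibniz' rule stops after two terms, as higher derivatives of the affine factor vanish.\<close>
lemma higher_deriv_affine_mult:
  fixes \<alpha> \<beta> :: complex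
  assumes G: "G holomorphic_on S" and S: "open S" and z: "z \<in> S"
  shows "(deriv ^^ Suc n) (\<lambda>w. (\<alpha> + \<beta> * w) * G w) z
    = (\<alpha> + \<beta> * z) * (deriv ^^ Suc n) G z + of_nat (Suc n) * \<beta> * (deriv ^^ n) G z"
  using z
proof (induction n arbitrary: z)
  case 0
  have "(G has_field_derivative deriv G z) (at z)"
    by (rule holomorphic_derivI[OF G S 0])
  then show ?case
    by (auto intro!: DERIV_imp_deriv derivative_eq_intros)
next
  case (Suc n)
  have D: "((deriv ^^ j) G has_field_derivative (deriv ^^ Suc j) G z) (at z)" for j
    using holomorphic_derivI[OF holomorphic_higher_deriv[OF G S] S Suc.prems] by simp
  have "((\<lambda>z. (\<alpha> + \<beta> * z) * (deriv ^^ Suc n) G z + of_nat (Suc n) * \<beta> * (deriv ^^ n) G z)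
     has_field_derivative (\<alpha> + \<beta> * z) * (deriv ^^ Suc (Suc n)) G z + of_nat (Suc (Suc n)) * \<beta> * (deriv ^^ Suc n) G z) (at z)"
    using D[of "Suc n"] D[of n] by (auto intro!: derivative_eq_intros simp: algebra_simps)
  then have "((deriv ^^ Suc n) (\<lambda>w. (\<alpha> + \<beta> * w) * G w) has_field_derivative
      (\<alpha> + \<beta> * z) * (deriv ^^ Suc (Suc n)) G z + of_nat (Suc (Suc n)) * \<beta> * (deriv ^^ Suc n) G z) (at z)"
    by (rule has_field_derivative_transform_within_open[OF _ S Suc.prems]) (simp add: Suc.IH del: funpow.simps)
  then show ?case
    by (simp add: DERIV_imp_deriv)
qed

lemma disc_involution_has_field_derivative:
  assumes "cmod a < 1" "z \<in> unit_disc"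
  shows "(disc_involution a has_field_derivative - of_real (1 - (cmod a)\<^sup>2) / (1 - cnj a * z)\<^sup>2) (at z)"
  unfolding disc_involution_def using involution_denominator_nonzero[of a z] assms unfolding of_real_one_minus_cmod_sq
  by (auto intro!: derivative_eq_intros simp: power2_eq_square algebra_simps)

text \<open>Bol's lemma. In the induction step one more factor \<open>L = 1 - cnj a z\<close> is split off. Differentiating
  the formula for \<open>n\<close> yields, up to this factor, the desired term and a multiple of \<open>f^(n+1) o \<phi>\<close>; the second term of the
  Leibniz rule for the new factor cancels that multiple.\<close>
lemma higher_deriv_involution:
  assumes a: "cmod a < 1" and f: "f holomorphic_on unit_disc" and z: "z \<in> unit_disc"
  shows "(deriv ^^ Suc n) (\<lambda>z. (1 - cnj a * z) ^ n * f (disc_involution a z)) z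
    = (- of_real (1 - (cmod a)\<^sup>2)) ^ Suc n * (deriv ^^ Suc n) f (disc_involution a z) / (1 - cnj a * z) ^ (n + 2)"
  using z
proof (induction n arbitrary: z)
  case (0 z)
  have "disc_involution a z \<in> unit_disc" using 0 a by (simp add: disc_involution_in_disc)
  from DERIV_chain2[OF holomorphic_derivI[OF f open_ball this] disc_involution_has_field_derivative[OF a 0]]
  show ?case
    by (simp add: DERIV_imp_deriv power2_eq_square)
next
  case (Suc n z)
  let ?c = "- complex_of_real (1 - (cmod a)\<^sup>2)"
  define G where "G = (\<lambda>z. (1 - cnj a * z) ^ n * f (disc_involution a z))"
  define R where "R = (\<lambda>z. ?c ^ Suc n * (deriv ^^ Suc n) f (disc_involution a z) / (1 - cnj a * z) ^ (n + 2))"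
  have IH: "(deriv ^^ Suc n) G w = R w" if "w \<in> unit_disc" for w
    using Suc.IH[OF that] by (simp only: G_def R_def)
  have G: "G holomorphic_on unit_disc"
    unfolding G_def by (intro holomorphic_intros holomorphic_compose_involution a f)
  define L where "L = 1 - cnj a * z"
  have L: "L \<noteq> 0" using involution_denominator_nonzero[of a z] a Suc.prems by (simp add: L_def)
  define u where "u = (deriv ^^ Suc n) f (disc_involution a z)"
  define v where "v = (deriv ^^ Suc (Suc n)) f (disc_involution a z)"
  have "disc_involution a z \<in> unit_disc" using Suc.prems a by (simp add: disc_involution_in_disc)
  then have "((deriv ^^ Suc n) f has_field_derivative v) (at (disc_involution a z))"
    using holomorphic_derivI[OF holomorphic_higher_deriv[OF f open_ball, of "Suc n"] open_ball] by (simp add: v_def)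
  from DERIV_chain2[OF this disc_involution_has_field_derivative[OF a Suc.prems]]
  have D: "((\<lambda>z. (deriv ^^ Suc n) f (disc_involution a z)) has_field_derivative v * (?c / L\<^sup>2)) (at z)"
    by (simp only: L_def)
  have "(R has_field_derivative
     (?c ^ Suc n * (v * (?c / L\<^sup>2)) * L ^ (n + 2)
       - ?c ^ Suc n * u * (of_nat (n + 2) * L ^ (n + 1) * (- cnj a))) / (L ^ (n + 2))\<^sup>2) (at z)"
  proof -
    have "((\<lambda>z. (1 - cnj a * z) ^ (n + 2)) has_field_derivative of_nat (n + 2) * L ^ (n + 1) * (- cnj a)) (at z)"
    proof -
      have "((\<lambda>z. 1 - cnj a * z) has_field_derivative - cnj a) (at z)"
        by (auto intro!: derivative_eq_intros)
      from DERIV_power[OF this, of "n + 2"] show ?thesis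
        by (simp add: L_def mult_ac)
    qed
    from DERIV_divide[OF DERIV_cmult[OF D, of "?c ^ Suc n"] this] show ?thesis
      using L unfolding R_def L_def u_def power2_eq_square by simp
  qed
  also have "(?c ^ Suc n * (v * (?c / L\<^sup>2)) * L ^ (n + 2)
       - ?c ^ Suc n * u * (of_nat (n + 2) * L ^ (n + 1) * (- cnj a))) / (L ^ (n + 2))\<^sup>2
     = ?c ^ Suc (Suc n) * v / L ^ (n + 4) + ?c ^ Suc n * u * of_nat (n + 2) * cnj a / L ^ (n + 3)"
    using L by (simp add: divide_simps power_add power2_eq_square eval_nat_numeral) (simp add: algebra_simps)
  finally have "((deriv ^^ Suc n) G has_field_derivative
     ?c ^ Suc (Suc n) * v / L ^ (n + 4) + ?c ^ Suc n * u * of_nat (n + 2) * cnj a / L ^ (n + 3)) (at z)"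
    by (rule has_field_derivative_transform_within_open[OF _ open_ball Suc.prems]) (simp only: IH)
  then have D2: "(deriv ^^ Suc (Suc n)) G z = ?c ^ Suc (Suc n) * v / L ^ (n + 4) + ?c ^ Suc n * u * of_nat (n + 2) * cnj a / L ^ (n + 3)"
    by (simp add: DERIV_imp_deriv)
  have "(deriv ^^ Suc (Suc n)) (\<lambda>z. (1 - cnj a * z) ^ Suc n * f (disc_involution a z)) z
     = (deriv ^^ Suc (Suc n)) (\<lambda>w. (1 + (- cnj a) * w) * G w) z"
    by (simp add: G_def mult.assoc del: funpow.simps)
  also have "\<dots> = (1 + (- cnj a) * z) * (deriv ^^ Suc (Suc n)) G z + of_nat (Suc (Suc n)) * (- cnj a) * (deriv ^^ Suc n) G z"
    by (rule higher_deriv_affine_mult[OF G open_ball Suc.prems])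
  also have "\<dots> = L * (?c ^ Suc (Suc n) * v / L ^ (n + 4) + ?c ^ Suc n * u * of_nat (n + 2) * cnj a / L ^ (n + 3))
     - of_nat (n + 2) * cnj a * (?c ^ Suc n * u / L ^ (n + 2))"
    unfolding D2 IH[OF Suc.prems] by (simp add: R_def L_def u_def del: funpow.simps)
  also have "\<dots> = ?c ^ Suc (Suc n) * v / L ^ (Suc n + 2)"
    using L by (simp add: divide_simps power_add eval_nat_numeral)
  finally show ?case by (simp only: L_def v_def)
qed

section \<open>The theorem at the origin\<close>

text \<open>The form of the Taylor expansion in which the moments of the weight are given as gauge integrals.\<close>
lemma nn_integral_disc_area_taylor_moments:
  fixes w :: "real \<Rightarrow> real"
  assumes h: "h holomorphic_on unit_disc" and w: "w \<in> borel_measurable borel"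
    and nonneg: "\<And>t. t \<in> {0..1} \<Longrightarrow> w t \<ge> 0"
    and I: "\<And>m. ((\<lambda>t. t ^ m * w t) has_integral I m) {0..1}"
  shows "(\<integral>\<^sup>+z. ennreal ((cmod (h z))\<^sup>2 * w ((cmod z)\<^sup>2)) \<partial>disc_area)
    = (\<Sum>m. ennreal ((cmod ((deriv ^^ m) h 0 / fact m))\<^sup>2 * I m))"
proof -
  have "(\<integral>\<^sup>+z. ennreal ((cmod (h z))\<^sup>2 * w ((cmod z)\<^sup>2)) \<partial>disc_area)
     = (\<integral>\<^sup>+z. ennreal ((cmod (h z))\<^sup>2) * ennreal (w ((cmod z)\<^sup>2)) \<partial>disc_area)"
    by (simp add: ennreal_mult')
  also have "\<dots> = (\<Sum>m. ennreal ((cmod ((deriv ^^ m) h 0 / fact m))\<^sup>2)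
       * (\<integral>\<^sup>+t. ennreal (t ^ m) * ennreal (w t) * indicator {0..1} t \<partial>lborel))"
    using w by (intro nn_integral_disc_area_taylor h) simp
  also have "(\<lambda>m. \<integral>\<^sup>+t. ennreal (t ^ m) * ennreal (w t) * indicator {0..1} t \<partial>lborel) = (\<lambda>m. ennreal (I m))"
  proof
    fix m
    have "(\<integral>\<^sup>+t. ennreal (t ^ m) * ennreal (w t) * indicator {0..1} t \<partial>lborel)
       = (\<integral>\<^sup>+t. ennreal (t ^ m * w t) * indicator {0..1} t \<partial>lborel)"
      by (intro nn_integral_cong) (auto simp: ennreal_mult' split: split_indicator)
    also have "\<dots> = ennreal (I m)"
      using nonneg by (intro nn_integral_has_integral_lebesgue' I) simp
    finally show "(\<integral>\<^sup>+t. ennreal (t ^ m) * ennreal (w t) * indicator {0..1} t \<partial>lborel) = ennreal (I m)" .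
  qed
  finally show ?thesis
    by (simp add: ennreal_mult')
qed

text \<open>For \<open>n > 0\<close> the coefficients come from the beta integral, for \<open>n = 0\<close> from Parseval. They
  have a common form.\<close>
lemma D_sigma_taylor:
  assumes h: "h holomorphic_on unit_disc"
  shows "D_sigma n h = (\<Sum>m. ennreal ((cmod ((deriv ^^ (m + n)) h 0))\<^sup>2 / (fact m * fact n * fact (m + n))))"
proof (cases n)
  case 0
  then show ?thesis
    by (simp add: D_sigma_def hardy2_norm_sq_taylor[OF h] norm_divide power_divide power2_eq_square)
next
  case (Suc p)
  have "(\<integral>\<^sup>+z. ennreal ((cmod ((deriv ^^ n) h z))\<^sup>2 * (1 - (cmod z)\<^sup>2) ^ p) \<partial>disc_area)
    = (\<Sum>m. ennreal ((cmod ((deriv ^^ m) ((deriv ^^ n) h) 0 / fact m))\<^sup>2 * (fact m * fact p / fact (m + p + 1))))"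
    using has_integral_power_one_minus_power
    by (intro nn_integral_disc_area_taylor_moments[of _ "\<lambda>t. (1 - t) ^ p"] holomorphic_higher_deriv h) auto
  then have "D_sigma n h = ennreal (1 / (fact n * fact p)) *
     (\<Sum>m. ennreal ((cmod ((deriv ^^ m) ((deriv ^^ n) h) 0 / fact m))\<^sup>2 * (fact m * fact p / fact (m + p + 1))))"
    by (simp add: D_sigma_def Suc)
  also have "\<dots> = (\<Sum>m. ennreal (1 / (fact n * fact p)) *
      ennreal ((cmod ((deriv ^^ m) ((deriv ^^ n) h) 0 / fact m))\<^sup>2 * (fact m * fact p / fact (m + p + 1))))"
    by (rule ennreal_suminf_cmult[symmetric])
  also have "\<dots> = (\<Sum>m. ennreal ((cmod ((deriv ^^ (m + n)) h 0))\<^sup>2 / (fact m * fact n * fact (m + n))))"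
  proof (intro arg_cong[of _ _ suminf] ext)
    fix m
    have "(deriv ^^ m) ((deriv ^^ n) h) 0 = (deriv ^^ (m + n)) h 0"
      by (simp add: funpow_add)
    moreover have "m + p + 1 = m + n" by (simp add: Suc)
    moreover have "1 / (fact n * fact p) * ((cmod (x / fact m))\<^sup>2 * (fact m * fact p / X)) = (cmod x)\<^sup>2 / (fact m * fact n * X)"
      for x :: complex and X :: real
      by (simp add: norm_divide power_divide power2_eq_square)
    moreover have "0 \<le> 1 / (fact n * fact p :: real)" by simp
    note ennreal_mult'[OF this, symmetric]
    ultimately show "ennreal (1 / (fact n * fact p)) *
      ennreal ((cmod ((deriv ^^ m) ((deriv ^^ n) h) 0 / fact m))\<^sup>2 * (fact m * fact p / fact (m + p + 1)))
      = ennreal ((cmod ((deriv ^^ (m + n)) h 0))\<^sup>2 / (fact m * fact n * fact (m + n)))"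
      by (simp only:)
  qed
  finally show ?thesis .
qed

lemma D_sigma_cong:
  assumes "f holomorphic_on unit_disc" "g holomorphic_on unit_disc" "\<And>z. z \<in> unit_disc \<Longrightarrow> f z = g z"
  shows "D_sigma n f = D_sigma n g"
proof -
  have "(deriv ^^ m) f 0 = (deriv ^^ m) g 0" for m
    by (rule higher_deriv_transform_within_open[OF assms(1,2) open_ball _ assms(3)]) auto
  then show ?thesis
    by (simp add: D_sigma_taylor assms(1,2))
qed

lemma D_sigma_cmult:
  assumes f: "f holomorphic_on unit_disc"
  shows "D_sigma n (\<lambda>z. k * f z) = ennreal ((cmod k)\<^sup>2) * D_sigma n f"
proof -
  have "(\<lambda>z. k * f z) holomorphic_on unit_disc"
    using f by (intro holomorphic_intros)
  moreover have "(deriv ^^ m) (\<lambda>z. k * f z) 0 = k * (deriv ^^ m) f 0" for m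
    by (rule higher_deriv_cmult[OF f]) auto
  ultimately have "D_sigma n (\<lambda>z. k * f z) = (\<Sum>m. ennreal ((cmod k)\<^sup>2 * ((cmod ((deriv ^^ (m + n)) f 0))\<^sup>2 / (fact m * fact n * fact (m + n)))))"
    by (simp add: D_sigma_taylor norm_mult power_mult_distrib)
  also have "\<dots> = ennreal ((cmod k)\<^sup>2) * D_sigma n f"
    unfolding D_sigma_taylor[OF f] by (simp only: ennreal_mult'[OF zero_le_power2] ennreal_suminf_cmult)
  finally show ?thesis .
qed

lemma log_remainder_measurable: "log_remainder n \<in> borel_measurable borel"
  unfolding log_remainder_def by measurable

lemma D_point_0_taylor:
  assumes g: "g holomorphic_on unit_disc"
  shows "D_point 0 (Suc n) g = (\<Sum>m. ennreal ((cmod ((deriv ^^ (m + Suc n)) g 0))\<^sup>2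
     / (fact m * fact n * fact (m + n + 1) * real (m + n + 1))))"
proof -
  have "((\<lambda>t. t ^ m * (log_remainder n t / (fact n)\<^sup>2)) has_integral
      fact n * fact m / (fact (m + n + 1) * real (m + n + 1)) / (fact n)\<^sup>2) {0..1}" for m
    using has_integral_divide[OF has_integral_power_log_remainder[of m n], of "(fact n)\<^sup>2"] by simp
  then have "D_point 0 (Suc n) g = (\<Sum>m. ennreal ((cmod ((deriv ^^ m) ((deriv ^^ Suc n) g) 0 / fact m))\<^sup>2
      * (fact n * fact m / (fact (m + n + 1) * real (m + n + 1)) / (fact n)\<^sup>2)))"
    unfolding D_point_def U_weight_0 using log_remainder_measurable[of n]
    by (intro nn_integral_disc_area_taylor_moments[of _ "\<lambda>t. log_remainder n t / (fact n)\<^sup>2"] holomorphic_higher_deriv g)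
      (auto simp: log_remainder_nonneg simp del: funpow.simps)
  also have "\<dots> = (\<Sum>m. ennreal ((cmod ((deriv ^^ (m + Suc n)) g 0))\<^sup>2
     / (fact m * fact n * fact (m + n + 1) * real (m + n + 1))))"
  proof (intro arg_cong[of _ _ suminf] ext arg_cong[of _ _ ennreal])
    fix m
    have "(deriv ^^ m) ((deriv ^^ Suc n) g) 0 = (deriv ^^ (m + Suc n)) g 0"
      by (simp only: funpow_add o_apply)
    moreover have "(cmod (x / fact m))\<^sup>2 * (fact n * fact m / (X * Y) / (fact n)\<^sup>2) = (cmod x)\<^sup>2 / (fact m * fact n * X * Y)"
      for x :: complex and X Y :: real
      by (simp add: norm_divide power_divide power2_eq_square)
    ultimately show "(cmod ((deriv ^^ m) ((deriv ^^ Suc n) g) 0 / fact m))\<^sup>2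
      * (fact n * fact m / (fact (m + n + 1) * real (m + n + 1)) / (fact n)\<^sup>2)
      = (cmod ((deriv ^^ (m + Suc n)) g 0))\<^sup>2 / (fact m * fact n * fact (m + n + 1) * real (m + n + 1))"
      by (simp only:)
  qed
  finally show ?thesis .
qed

text \<open>Differentiate \<open>g(z) - g(0) = z q(z)\<close>, where \<open>q\<close> is the difference quotient.\<close>
lemma higher_deriv_diff_quotient_0:
  assumes g: "g holomorphic_on unit_disc"
  shows "(deriv ^^ Suc j) g 0 = of_nat (Suc j) * (deriv ^^ j) (diff_quotient g 0) 0"
proof -
  have q: "diff_quotient g 0 holomorphic_on unit_disc"
    using g by (rule diff_quotient_holomorphic) simp
  have "(deriv ^^ Suc j) g 0 = (deriv ^^ Suc j) (\<lambda>w. g w - g 0) 0"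
    by (subst higher_deriv_diff[OF g _ open_ball]) (auto simp del: funpow.simps)
  also have "\<dots> = (deriv ^^ Suc j) (\<lambda>w. (0 + 1 * w) * diff_quotient g 0 w) 0"
  proof (rule higher_deriv_transform_within_open[OF _ _ open_ball])
    show "(\<lambda>w. g w - g 0) holomorphic_on unit_disc"
      using g by (intro holomorphic_intros)
    show "(\<lambda>w. (0 + 1 * w) * diff_quotient g 0 w) holomorphic_on unit_disc"
      using q by (intro holomorphic_intros)
  qed (auto simp: diff_quotient_def)
  also have "\<dots> = of_nat (Suc j) * (deriv ^^ j) (diff_quotient g 0) 0"
    by (subst higher_deriv_affine_mult[OF q open_ball]) auto
  finally show ?thesis .
qed

text \<open>Term by term: the derivative of order \<open>m + n + 1\<close> of \<open>g\<close> at \<open>0\<close> is \<open>m + n + 1\<close> times the derivative of order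
  \<open>m + n\<close> of the difference quotient, which absorbs the two extra factors \<open>m + n + 1\<close>.\<close>
lemma D_point_0_eq_D_sigma:
  assumes g: "g holomorphic_on unit_disc"
  shows "D_point 0 (Suc n) g = D_sigma n (diff_quotient g 0)"
proof -
  have q: "diff_quotient g 0 holomorphic_on unit_disc"
    using g by (rule diff_quotient_holomorphic) simp
  have "(cmod ((deriv ^^ (m + Suc n)) g 0))\<^sup>2 / (fact m * fact n * fact (m + n + 1) * real (m + n + 1))
     = (cmod ((deriv ^^ (m + n)) (diff_quotient g 0) 0))\<^sup>2 / (fact m * fact n * fact (m + n))" for m
  proof -
    have "(cmod ((deriv ^^ (m + Suc n)) g 0))\<^sup>2 = (real (m + n + 1))\<^sup>2 * (cmod ((deriv ^^ (m + n)) (diff_quotient g 0) 0))\<^sup>2"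
      using higher_deriv_diff_quotient_0[OF g, of "m + n"]
      by (simp add: norm_mult power_mult_distrib del: funpow.simps of_nat_Suc)
    moreover have "fact (m + n + 1) = real (m + n + 1) * fact (m + n)" by simp
    ultimately show ?thesis
      by (simp add: power2_eq_square del: of_nat_add fact_Suc)
  qed
  then show ?thesis
    unfolding D_point_0_taylor[OF g] D_sigma_taylor[OF q] by (simp only:)
qed

section \<open>Covariance under the involution\<close>

text \<open>With \<open>q = (1 - |a|\<^sup>2) / |1 - cnj a z|\<close> one has \<open>|a - \<phi>(z)| = q |z|\<close> and
  \<open>(1 - |a|\<^sup>2) (1 - |\<phi>(z)|\<^sup>2) = q\<^sup>2 (1 - |z|\<^sup>2)\<close>. Each summand of the kernel of order \<open>n + 1\<close> has total degree \<open>n\<close> in the squared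
  distance and in the product of the defects \<open>1 - |.|\<^sup>2\<close>, so it picks up exactly \<open>q^(2n)\<close>; the argument of
  the logarithm is invariant.\<close>
lemma U_weight_involution:
  assumes a: "cmod a < 1" and z: "z \<in> unit_disc"
  shows "(1 - (cmod a)\<^sup>2) * U_weight a (Suc n) (disc_involution a z)
    = ((1 - (cmod a)\<^sup>2) / (cmod (1 - cnj a * z))\<^sup>2) ^ n * U_weight 0 (Suc n) z"
proof -
  define c where "c = 1 - (cmod a)\<^sup>2"
  define L where "L = 1 - cnj a * z"
  define q where "q = c / cmod L"
  have c: "c > 0" using a by (simp add: c_def abs_square_less_1)
  have L: "L \<noteq> 0" using involution_denominator_nonzero[of a z] a z by (simp add: L_def)
  have cc: "complex_of_real c = 1 - a * cnj a" unfolding c_def by (rule of_real_one_minus_cmod_sq)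
  have 1: "a - disc_involution a z = z * (of_real c / L)"
    using L unfolding cc disc_involution_def L_def[symmetric] by (simp add: field_simps) (simp add: L_def algebra_simps)
  have 2: "1 - disc_involution a z * cnj a = of_real c / L"
    using L unfolding cc disc_involution_def L_def[symmetric] by (simp add: field_simps) (simp add: L_def algebra_simps)
  have n1: "cmod (a - disc_involution a z) = cmod z * q"
    using c unfolding 1 by (simp add: norm_mult norm_divide q_def)
  \<comment> \<open>holds for \<open>z = 0\<close> too, since both quotients are then \<open>0\<close>\<close>
  have n2: "(1 - disc_involution a z * cnj a) / (a - disc_involution a z) = 1 / z"
    using c L unfolding 1 2 by simp
  have n3: "c * (1 - (cmod (disc_involution a z))\<^sup>2) = q\<^sup>2 * (1 - (cmod z)\<^sup>2)"
    using one_minus_cmod_disc_involution[of a z] a z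
    by (simp add: q_def power_divide flip: c_def L_def) (simp add: power2_eq_square)
  have terms: "(-1) ^ l / real l * cmod (a - disc_involution a z) ^ (2 * (Suc n - 1 - l)) * (1 - (cmod a)\<^sup>2) ^ l
       * (1 - (cmod (disc_involution a z))\<^sup>2) ^ l
     = q ^ (2 * n) * ((-1) ^ l / real l * cmod (0 - z) ^ (2 * (Suc n - 1 - l)) * (1 - (cmod 0)\<^sup>2) ^ l * (1 - (cmod z)\<^sup>2) ^ l)"
    if "l \<in> {1..Suc n - 1}" for l
  proof -
    have "(1 - (cmod a)\<^sup>2) ^ l * (1 - (cmod (disc_involution a z))\<^sup>2) ^ l = q ^ (2 * l) * (1 - (cmod z)\<^sup>2) ^ l"
      using n3 by (simp add: c_def power_mult flip: power_mult_distrib)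
    moreover have "2 * n = 2 * (n - l) + 2 * l" using that by auto
    then have "q ^ (2 * n) = q ^ (2 * (n - l)) * q ^ (2 * l)"
      by (simp only: power_add[symmetric])
    ultimately show ?thesis
      unfolding n1 by (simp add: power_mult_distrib mult.assoc)
  qed
  have log_term: "cmod (a - disc_involution a z) ^ (2 * (Suc n - 1))
        * ln ((cmod ((1 - disc_involution a z * cnj a) / (a - disc_involution a z)))\<^sup>2)
     = q ^ (2 * n) * (cmod (0 - z) ^ (2 * (Suc n - 1)) * ln ((cmod ((1 - z * cnj 0) / (0 - z)))\<^sup>2))"
    using n1 n2 by (simp add: power_mult_distrib norm_divide)
  have "G_kernel (Suc n) (disc_involution a z) a = q ^ (2 * n) * G_kernel (Suc n) z 0"
    unfolding G_kernel_def distrib_left sum_distrib_left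
    by (simp only: log_term sum.cong[OF refl terms])
  moreover have "q ^ (2 * n) = (c / (cmod L)\<^sup>2) ^ n * c ^ n"
    by (simp add: q_def power_mult power_divide power2_eq_square flip: power_mult_distrib)
  ultimately have "c * U_weight a (Suc n) (disc_involution a z) = (c / (cmod L)\<^sup>2) ^ n * U_weight 0 (Suc n) z"
    using c by (simp add: U_weight_def flip: c_def)
  then show ?thesis by (simp add: c_def L_def)
qed

lemma U_weight_measurable: "U_weight a k \<in> borel_measurable borel"
  unfolding U_weight_def G_kernel_def by measurable

lemma cmod_deriv_disc_involution:
  assumes a: "cmod a < 1" and z: "z \<in> unit_disc"
  shows "(cmod (deriv (disc_involution a) z))\<^sup>2 = ((1 - (cmod a)\<^sup>2) / (cmod (1 - cnj a * z))\<^sup>2)\<^sup>2"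
proof -
  have "0 \<le> 1 - (cmod a)\<^sup>2" using a by (simp add: abs_square_le_1)
  then show ?thesis
    unfolding DERIV_imp_deriv[OF disc_involution_has_field_derivative[OF a z]] norm_divide norm_minus_cancel norm_of_real norm_power
    by simp
qed

lemma nn_integral_disc_area_involution:
  assumes a: "cmod a < 1" and h: "h \<in> borel_measurable disc_area"
  shows "(\<integral>\<^sup>+z. h z \<partial>disc_area)
    = (\<integral>\<^sup>+z. ennreal (((1 - (cmod a)\<^sup>2) / (cmod (1 - cnj a * z))\<^sup>2)\<^sup>2) * h (disc_involution a z) \<partial>disc_area)"
proof -
  have "disc_involution a holomorphic_on unit_disc"
    using holomorphic_on_disc_involution[OF a] by (rule holomorphic_on_subset) auto
  from nn_integral_disc_area_substitution[OF this inj_on_disc_involution[OF a] image_disc_involution[OF a] h]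
  show ?thesis
    by (rule trans) (intro nn_integral_cong, simp add: cmod_deriv_disc_involution[OF a])
qed

lemma cmod_higher_deriv_involution:
  assumes a: "cmod a < 1" and f: "f holomorphic_on unit_disc" and z: "z \<in> unit_disc"
  shows "(cmod ((deriv ^^ Suc n) (\<lambda>z. (1 - cnj a * z) ^ n * f (disc_involution a z)) z))\<^sup>2
    = (1 - (cmod a)\<^sup>2) ^ n * ((1 - (cmod a)\<^sup>2) / (cmod (1 - cnj a * z))\<^sup>2) ^ (n + 2)
      * (cmod ((deriv ^^ Suc n) f (disc_involution a z)))\<^sup>2"
proof -
  define c where "c = 1 - (cmod a)\<^sup>2"
  have c: "c > 0" using a by (simp add: c_def abs_square_less_1)
  have "cmod ((deriv ^^ Suc n) (\<lambda>z. (1 - cnj a * z) ^ n * f (disc_involution a z)) z)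
    = c ^ Suc n * cmod ((deriv ^^ Suc n) f (disc_involution a z)) / cmod (1 - cnj a * z) ^ (n + 2)"
    unfolding higher_deriv_involution[OF a f z] c_def[symmetric] using c
    by (simp add: norm_mult norm_divide norm_power del: funpow.simps)
  moreover have "(c ^ Suc n * u / l ^ (n + 2))\<^sup>2 = c ^ n * (c / l\<^sup>2) ^ (n + 2) * u\<^sup>2" for l u :: real
  proof -
    have "(c ^ Suc n)\<^sup>2 = c ^ n * c ^ (n + 2)" by (simp add: power2_eq_square power_add)
    moreover have "(l ^ (n + 2))\<^sup>2 = (l\<^sup>2) ^ (n + 2)" by (metis power_mult mult.commute)
    ultimately show ?thesis by (simp add: power_divide power_mult_distrib del: power_Suc)
  qed
  ultimately show ?thesis by (simp only: c_def)
qed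

text \<open>Let \<open>r = (1 - |a|\<^sup>2) / |1 - cnj a z|\<^sup>2\<close>. The Jacobian contributes \<open>r\<^sup>2\<close>, the weight \<open>r^n\<close>, and Bol's lemma
  consumes \<open>r^(n+2)\<close>, so that only powers of \<open>1 - |a|\<^sup>2\<close> remain.\<close>
lemma D_point_involution:
  assumes a: "cmod a < 1" and f: "f holomorphic_on unit_disc"
  shows "D_point a (Suc n) f = ennreal (1 / (1 - (cmod a)\<^sup>2) ^ Suc n)
     * D_point 0 (Suc n) (\<lambda>z. (1 - cnj a * z) ^ n * f (disc_involution a z))"
proof -
  define c where "c = 1 - (cmod a)\<^sup>2"
  have c: "c > 0" using a by (simp add: c_def abs_square_less_1)
  define g where "g = (\<lambda>z. (1 - cnj a * z) ^ n * f (disc_involution a z))"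
  have g: "g holomorphic_on unit_disc"
    unfolding g_def by (intro holomorphic_intros holomorphic_compose_involution a f)
  have meas: "(\<lambda>z. ennreal ((cmod ((deriv ^^ Suc n) u z))\<^sup>2 * U_weight b (Suc n) z)) \<in> borel_measurable disc_area"
    if "u holomorphic_on unit_disc" for u b
    using holomorphic_measurable_disc_area[OF holomorphic_higher_deriv[OF that open_ball]]
      borel_measurable_disc_area[OF U_weight_measurable] by measurable
  have "D_point a (Suc n) f = (\<integral>\<^sup>+z. ennreal ((c / (cmod (1 - cnj a * z))\<^sup>2)\<^sup>2) *
     ennreal ((cmod ((deriv ^^ Suc n) f (disc_involution a z)))\<^sup>2 * U_weight a (Suc n) (disc_involution a z)) \<partial>disc_area)"
    unfolding D_point_def c_def by (rule nn_integral_disc_area_involution[OF a meas[OF f]])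
  also have "\<dots> = (\<integral>\<^sup>+z. ennreal (1 / c ^ Suc n) * ennreal ((cmod ((deriv ^^ Suc n) g z))\<^sup>2 * U_weight 0 (Suc n) z) \<partial>disc_area)"
  proof (rule nn_integral_cong)
    fix z assume "z \<in> space disc_area"
    then have z: "z \<in> unit_disc" by simp
    define r where "r = c / (cmod (1 - cnj a * z))\<^sup>2"
    define u where "u = (cmod ((deriv ^^ Suc n) f (disc_involution a z)))\<^sup>2"
    define U where "U = U_weight a (Suc n) (disc_involution a z)"
    have g': "(cmod ((deriv ^^ Suc n) g z))\<^sup>2 = c ^ n * r ^ (n + 2) * u"
      unfolding g_def c_def r_def u_def by (rule cmod_higher_deriv_involution[OF a f z])
    have U': "c * U = r ^ n * U_weight 0 (Suc n) z"
      unfolding c_def r_def U_def by (rule U_weight_involution[OF a z])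
    have "r\<^sup>2 * (u * U) = 1 / c * (r\<^sup>2 * u * (c * U))" using c by simp
    also have "\<dots> = 1 / c ^ Suc n * (c ^ n * r ^ (n + 2) * u * U_weight 0 (Suc n) z)"
      unfolding U' using c by (simp add: power_add power2_eq_square)
    finally show "ennreal (r\<^sup>2) * ennreal (u * U)
       = ennreal (1 / c ^ Suc n) * ennreal ((cmod ((deriv ^^ Suc n) g z))\<^sup>2 * U_weight 0 (Suc n) z)"
      unfolding g' using c by (subst (1 2) ennreal_mult'[symmetric]) (simp_all del: power_Suc)
  qed
  also have "\<dots> = ennreal (1 / c ^ Suc n) * D_point 0 (Suc n) g"
    unfolding D_point_def by (rule nn_integral_cmult[OF meas[OF g]])
  finally show ?thesis by (simp only: c_def g_def)
qed

text \<open>For \<open>n = p + 1\<close> the powers of \<open>r = (1 - |a|\<^sup>2) / |1 - cnj a z|\<^sup>2\<close> cancel again: \<open>r\<^sup>2\<close> from the Jacobian, \<open>r^p\<close> from the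
  weight, \<open>r^(p+2)\<close> from Bol's lemma. For \<open>n = 0\<close> it is the isometry of \<open>H\<^sup>2\<close>. Writing the factor as
  \<open>(1 - cnj a z)^n / (1 - cnj a z)\<close> covers both cases.\<close>
lemma D_sigma_involution:
  assumes a: "cmod a < 1" and f: "f holomorphic_on unit_disc"
  shows "D_sigma n f = ennreal ((1 - (cmod a)\<^sup>2) / (1 - (cmod a)\<^sup>2) ^ n)
     * D_sigma n (\<lambda>z. (1 - cnj a * z) ^ n * f (disc_involution a z) / (1 - cnj a * z))"
proof (cases n)
  case 0
  then show ?thesis
    using hardy2_norm_sq_involution[OF a f] by (simp add: D_sigma_def)
next
  case (Suc p)
  define c where "c = 1 - (cmod a)\<^sup>2"
  have c: "c > 0" using a by (simp add: c_def abs_square_less_1)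
  define h where "h = (\<lambda>z. (1 - cnj a * z) ^ p * f (disc_involution a z))"
  have h: "h holomorphic_on unit_disc"
    unfolding h_def by (intro holomorphic_intros holomorphic_compose_involution a f)
  have nz: "1 - cnj a * z \<noteq> 0" if "z \<in> unit_disc" for z
    using involution_denominator_nonzero[OF a] that by simp
  have meas: "(\<lambda>z. ennreal ((cmod ((deriv ^^ Suc p) u z))\<^sup>2 * (1 - (cmod z)\<^sup>2) ^ p)) \<in> borel_measurable disc_area"
    if "u holomorphic_on unit_disc" for u
  proof -
    have "(\<lambda>z. (1 - (cmod z)\<^sup>2) ^ p) \<in> borel_measurable disc_area"
      by (rule borel_measurable_disc_area) measurable
    then show ?thesis
      using holomorphic_measurable_disc_area[OF holomorphic_higher_deriv[OF that open_ball]] by measurable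
  qed
  have "(\<integral>\<^sup>+z. ennreal ((cmod ((deriv ^^ Suc p) f z))\<^sup>2 * (1 - (cmod z)\<^sup>2) ^ p) \<partial>disc_area)
     = (\<integral>\<^sup>+z. ennreal ((c / (cmod (1 - cnj a * z))\<^sup>2)\<^sup>2) *
     ennreal ((cmod ((deriv ^^ Suc p) f (disc_involution a z)))\<^sup>2 * (1 - (cmod (disc_involution a z))\<^sup>2) ^ p) \<partial>disc_area)"
    unfolding c_def by (rule nn_integral_disc_area_involution[OF a meas[OF f]])
  also have "\<dots> = (\<integral>\<^sup>+z. ennreal (1 / c ^ p) * ennreal ((cmod ((deriv ^^ Suc p) h z))\<^sup>2 * (1 - (cmod z)\<^sup>2) ^ p) \<partial>disc_area)"
  proof (rule nn_integral_cong)
    fix z assume "z \<in> space disc_area"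
    then have z: "z \<in> unit_disc" by simp
    define r where "r = c / (cmod (1 - cnj a * z))\<^sup>2"
    define u where "u = (cmod ((deriv ^^ Suc p) f (disc_involution a z)))\<^sup>2"
    have h': "(cmod ((deriv ^^ Suc p) h z))\<^sup>2 = c ^ p * r ^ (p + 2) * u"
      unfolding h_def c_def r_def u_def by (rule cmod_higher_deriv_involution[OF a f z])
    have w: "1 - (cmod (disc_involution a z))\<^sup>2 = r * (1 - (cmod z)\<^sup>2)"
      using one_minus_cmod_disc_involution[of a z] a z by (simp add: r_def c_def)
    have nonneg: "0 \<le> 1 / c ^ p" using c by simp
    have "r\<^sup>2 * (u * (r * (1 - (cmod z)\<^sup>2)) ^ p) = 1 / c ^ p * (c ^ p * r ^ (p + 2) * u * (1 - (cmod z)\<^sup>2) ^ p)"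
      using c by (simp add: power_add power_mult_distrib power2_eq_square)
    then show "ennreal (r\<^sup>2) * ennreal (u * (1 - (cmod (disc_involution a z))\<^sup>2) ^ p)
       = ennreal (1 / c ^ p) * ennreal ((cmod ((deriv ^^ Suc p) h z))\<^sup>2 * (1 - (cmod z)\<^sup>2) ^ p)"
      by (simp only: h' w ennreal_mult'[OF zero_le_power2, symmetric] ennreal_mult'[OF nonneg, symmetric])
  qed
  also have "\<dots> = ennreal (1 / c ^ p) * (\<integral>\<^sup>+z. ennreal ((cmod ((deriv ^^ Suc p) h z))\<^sup>2 * (1 - (cmod z)\<^sup>2) ^ p) \<partial>disc_area)"
    by (rule nn_integral_cmult[OF meas[OF h]])
  finally have "D_sigma n f = ennreal (1 / c ^ p) * D_sigma n h"
    by (simp add: D_sigma_def Suc mult.left_commute del: funpow.simps)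
  also have "D_sigma n h = D_sigma n (\<lambda>z. (1 - cnj a * z) ^ n * f (disc_involution a z) / (1 - cnj a * z))"
    using nz by (intro D_sigma_cong h holomorphic_intros holomorphic_compose_involution a f)
      (auto simp: h_def Suc)
  also have "1 / c ^ p = c / c ^ n" using c by (simp add: Suc)
  finally show ?thesis by (simp only: c_def)
qed

section \<open>The theorem at an arbitrary point\<close>

text \<open>Away from the origin this is \<open>\<phi>(z) - a = - (1 - |a|\<^sup>2) z / (1 - cnj a z)\<close>. At the origin it is the chain rule,
  as \<open>f(a) = 0\<close> kills the derivative of the power.\<close>
lemma diff_quotient_involution:
  assumes a: "cmod a < 1" and f: "f holomorphic_on unit_disc" and fa: "f a = 0" and z: "z \<in> unit_disc"
  shows "(1 - cnj a * z) ^ n * diff_quotient f a (disc_involution a z) / (1 - cnj a * z)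
    = - 1 / of_real (1 - (cmod a)\<^sup>2) * diff_quotient (\<lambda>z. (1 - cnj a * z) ^ n * f (disc_involution a z)) 0 z"
proof -
  have c0: "1 - (cmod a)\<^sup>2 \<noteq> 0" using a abs_square_less_1[of "cmod a"] by simp
  show ?thesis
  proof (cases "z = 0")
    case True
    have "(f has_field_derivative deriv f a) (at (disc_involution a 0))"
      using holomorphic_derivI[OF f open_ball, of a] a by simp
    from DERIV_chain2[OF this disc_involution_has_field_derivative[OF a, of 0]]
    have "((\<lambda>z. f (disc_involution a z)) has_field_derivative deriv f a * - of_real (1 - (cmod a)\<^sup>2)) (at 0)"
      by simp
    moreover have "((\<lambda>z. (1 - cnj a * z) ^ n) has_field_derivative deriv (\<lambda>z. (1 - cnj a * z) ^ n) 0) (at 0)"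
      by (rule holomorphic_derivI[of _ UNIV]) (auto intro!: holomorphic_intros)
    ultimately have "((\<lambda>z. (1 - cnj a * z) ^ n * f (disc_involution a z)) has_field_derivative
        deriv f a * - of_real (1 - (cmod a)\<^sup>2)) (at 0)"
      using DERIV_mult[of "\<lambda>z. (1 - cnj a * z) ^ n" _ 0 UNIV "\<lambda>z. f (disc_involution a z)"] fa by simp
    then have "deriv (\<lambda>z. (1 - cnj a * z) ^ n * f (disc_involution a z)) 0 = deriv f a * - of_real (1 - (cmod a)\<^sup>2)"
      by (rule DERIV_imp_deriv)
    then show ?thesis
      using c0 unfolding True diff_quotient_def by (simp del: of_real_diff of_real_power)
  next
    case False
    define L where "L = 1 - cnj a * z"
    have L: "L \<noteq> 0" using involution_denominator_nonzero[of a z] a z by (simp add: L_def)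
    have d: "disc_involution a z - a = - (z * of_real (1 - (cmod a)\<^sup>2) / L)"
      using L unfolding of_real_one_minus_cmod_sq disc_involution_def L_def[symmetric]
      by (simp add: field_simps) (simp add: L_def algebra_simps)
    then have "disc_involution a z \<noteq> a"
      using False L c0 by (metis divide_eq_0_iff eq_iff_diff_eq_0 mult_eq_0_iff neg_equal_0_iff_equal of_real_eq_0_iff)
    then show ?thesis
      using False L c0 unfolding diff_quotient_def
      by (simp add: d fa flip: L_def del: of_real_diff of_real_power)
  qed
qed

lemma D_point_eq_D_sigma_of_zero:
  assumes a: "cmod a < 1" and f: "f holomorphic_on unit_disc" and fa: "f a = 0"
  shows "D_point a (Suc n) f = D_sigma n (diff_quotient f a)"
proof -
  define c where "c = 1 - (cmod a)\<^sup>2"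
  have c: "c > 0" using a by (simp add: c_def abs_square_less_1)
  define g where "g = (\<lambda>z. (1 - cnj a * z) ^ n * f (disc_involution a z))"
  have g: "g holomorphic_on unit_disc"
    unfolding g_def by (intro holomorphic_intros holomorphic_compose_involution a f)
  have q: "diff_quotient g 0 holomorphic_on unit_disc"
    using g by (rule diff_quotient_holomorphic) simp
  have F: "diff_quotient f a holomorphic_on unit_disc"
    using f by (rule diff_quotient_holomorphic) (use a in simp)
  have nz: "1 - cnj a * z \<noteq> 0" if "z \<in> unit_disc" for z
    using involution_denominator_nonzero[OF a] that by simp
  have "D_sigma n (diff_quotient f a) = ennreal (c / c ^ n) *
     D_sigma n (\<lambda>z. (1 - cnj a * z) ^ n * diff_quotient f a (disc_involution a z) / (1 - cnj a * z))"
    unfolding c_def by (rule D_sigma_involution[OF a F])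
  also have "D_sigma n (\<lambda>z. (1 - cnj a * z) ^ n * diff_quotient f a (disc_involution a z) / (1 - cnj a * z))
     = D_sigma n (\<lambda>z. - 1 / of_real c * diff_quotient g 0 z)"
    using nz by (intro D_sigma_cong holomorphic_intros holomorphic_compose_involution a F q)
      (auto simp: g_def c_def diff_quotient_involution[OF a f fa])
  also have "\<dots> = ennreal ((1 / c)\<^sup>2) * D_sigma n (diff_quotient g 0)"
    using c D_sigma_cmult[OF q, of n "- 1 / of_real c"] by (simp add: norm_divide)
  also have "ennreal (c / c ^ n) * \<dots> = ennreal (1 / c ^ Suc n) * D_sigma n (diff_quotient g 0)"
    using c unfolding mult.assoc[symmetric]
    by (subst ennreal_mult'[symmetric]) (simp_all add: power2_eq_square mult.commute)
  also have "\<dots> = D_point a (Suc n) f"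
    unfolding D_point_0_eq_D_sigma[OF g, symmetric] unfolding c_def g_def
    by (rule D_point_involution[OF a f, symmetric])
  finally show ?thesis ..
qed

theorem theorem1p1:
  fixes k :: nat and \<zeta> :: complex and f :: "complex \<Rightarrow> complex"
  assumes "k \<ge> 1"
    and "\<zeta> \<in> unit_disc"
    and "f holomorphic_on unit_disc"
  shows "D_point \<zeta> k f = D_sigma (k - 1) (diff_quotient f \<zeta>)"
proof -
  obtain n where k: "k = Suc n" using assms(1) by (cases k) auto
  \<comment> \<open>subtracting a constant changes neither the \<open>k\<close>-th derivative nor the difference quotient\<close>
  define F where "F = (\<lambda>z. f z - f \<zeta>)"
  have F: "F holomorphic_on unit_disc"
    unfolding F_def using assms(3) by (intro holomorphic_intros)
  have "(deriv ^^ k) F z = (deriv ^^ k) f z" if "z \<in> unit_disc" for z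
    unfolding F_def k using that
    by (subst higher_deriv_diff[OF assms(3) _ open_ball]) (auto simp del: funpow.simps)
  then have "D_point \<zeta> k f = D_point \<zeta> k F"
    unfolding D_point_def by (intro nn_integral_cong) simp
  moreover have "deriv F \<zeta> = deriv f \<zeta>"
    using assms(2,3) unfolding F_def
    by (intro DERIV_imp_deriv) (auto intro!: derivative_eq_intros holomorphic_derivI)
  then have "diff_quotient F \<zeta> = diff_quotient f \<zeta>"
    by (auto simp: diff_quotient_def F_def)
  moreover have "D_point \<zeta> (Suc n) F = D_sigma n (diff_quotient F \<zeta>)"
    using assms(2) by (intro D_point_eq_D_sigma_of_zero F) (simp_all add: F_def)
  ultimately show ?thesis by (simp add: k)
qed

end
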